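(* Suppose $\mu$ is a (shift-invariant, fully supported) 1-step Markov measure on an irreducible shift of finite type $\Omega_A$, determined by a stochastic matrix $P$, and suppose that there are algorithms for doing arithmetic in the field generated by the entries of $P$. Suppose $\phi$ is a block code on $\Omega_A$. Then there is an algorithm for deciding whether the measure $\phi\mu$ is Markov, i.e., whether there exists $k\ge 1$ such that $\phi\mu$ is $k$-step Markov.
   Context: For an irreducible $0,1$ matrix $A$, $\Omega_A$ is the set of two-sided sequences $x$ over the (finite) index set of $A$ with $A(x_i,x_{i+1})=1$ for all $i\in\mathbb Z$, with the shift $\sigma$. The 1-step Markov measure determined by a stochastic matrix $P$ with the same zero/positive pattern as $A$ is given by $\mu(\{x:x[0,t]=a_0\cdots a_t\})=p(a_0)P(a_0,a_1)\cdots P(a_{t-1},a_t)$, where $p$ is the unique probability row vector with $pP=p$. A block code $\phi$ on $\Omega_A$ is a map of the form $(\phi x)_i=\Phi(x_{i-s}\cdots x_{i+t})$ for some $s,t\ge 0$ and some map $\Phi$ from words of length $s+t+1$ to a finite alphabet; its image $Y=\phi(\Omega_A)$ is a subshift, and $\phi\mu$ is the image measure $(\phi\mu)(E)=\mu(\phi^{-1}E)$ on $Y$. For $k\ge1$, a shift-invariant Borel probability measure $\nu$ on a subshift $Y$ is $k$-step Markov if for all $i\ge 0$, all $j\ge k$ and all $x\in Y$ with the relevant cylinders of positive measure, $$\nu\big(y[0,i]=x[0,i]\,\big|\,y[-j,-1]=x[-j,-1]\big)=\nu\big(y[0,i]=x[0,i]\,\big|\,y[-k,-1]=x[-k,-1]\big).$$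 "Algorithms for doing arithmetic" in a field means that field elements have finite representations for which the field operations and equality testing can be carried out algorithmically. The input to the decision algorithm is $A$, $P$ and the block map $\Phi$. *)

theory Defs
  imports
    "HOL-Probability.Probability"
    "HOL-Library.Nat_Bijection"
    "HOL-Algebra.Algebraic_Closure_Type"
    "HOL-Algebra.Generated_Fields"
    "Jordan_Normal_Form.Matrix"
begin

no_notation vec_nth (infixl \<open>$\<close> 90)

section \<open>Algorithms\<close>

text \<open>
  An algorithm is a partial recursive function on codes; \<^const>\<open>None\<close> means that the computation does
  not terminate.  The presentation is the one by unary functions, with \<^const>\<open>prod_encode\<close> as pairing:
  composition, pairing, primitive recursion with parameter and unbounded minimisation.
\<close>

inductive partial_recursive :: "(nat \<Rightarrow> nat option) \<Rightarrow> bool" where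
  zero: "partial_recursive (\<lambda>_. Some 0)"
| succ: "partial_recursive (\<lambda>x. Some (Suc x))"
| left: "partial_recursive (\<lambda>x. Some (fst (prod_decode x)))"
| right: "partial_recursive (\<lambda>x. Some (snd (prod_decode x)))"
| pair: "partial_recursive (\<lambda>x. Option.bind (f x) (\<lambda>u. Option.bind (g x) (\<lambda>v. Some (prod_encode (u, v)))))"
  if "partial_recursive f" "partial_recursive g"
| comp: "partial_recursive (\<lambda>x. Option.bind (g x) f)"
  if "partial_recursive f" "partial_recursive g"
| prec: "partial_recursive (\<lambda>x. case prod_decode x of (a, m) \<Rightarrow>
      rec_nat (f a) (\<lambda>k r. Option.bind r (\<lambda>v. g (prod_encode (a, prod_encode (k, v))))) m)"
  if "partial_recursive f" "partial_recursive g"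
| mini: "partial_recursive (\<lambda>a.
      if \<exists>m. f (prod_encode (a, m)) = Some 0 \<and> (\<forall>k<m. f (prod_encode (a, k)) \<noteq> None)
      then Some (LEAST m. f (prod_encode (a, m)) = Some 0) else None)"
  if "partial_recursive f"

text \<open>
  Algorithms for doing arithmetic in a field \<open>K\<close> of real numbers: every element of \<open>K\<close> is
  represented by at least one code (\<open>rep c = Some x\<close> means that \<open>c\<close> represents \<open>x\<close>; a natural number
  that represents nothing is mapped to \<^const>\<open>None\<close>), and the field operations and the equality test
  are carried out on codes.  Nothing is required of the algorithms on numbers that are not codes;
  in particular it need not be decidable whether a number is a code, and no order test on \<open>K\<close> is given.
\<close>

definition computes_unary :: "(nat \<rightharpoonup> real) \<Rightarrow> (nat \<Rightarrow> nat option) \<Rightarrow> (real \<Rightarrow> real) \<Rightarrow> real set \<Rightarrow> bool" where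
  "computes_unary rep f op S \<longleftrightarrow>
     (\<forall>a x. rep a = Some x \<and> x \<in> S \<longrightarrow> (\<exists>c. f a = Some c \<and> rep c = Some (op x)))"

definition computes_binary :: "(nat \<rightharpoonup> real) \<Rightarrow> (nat \<Rightarrow> nat option) \<Rightarrow> (real \<Rightarrow> real \<Rightarrow> real) \<Rightarrow> bool" where
  "computes_binary rep f op \<longleftrightarrow>
     (\<forall>a b x y. rep a = Some x \<and> rep b = Some y \<longrightarrow>
        (\<exists>c. f (prod_encode (a, b)) = Some c \<and> rep c = Some (op x y)))"

definition tests_equality :: "(nat \<rightharpoonup> real) \<Rightarrow> (nat \<Rightarrow> nat option) \<Rightarrow> bool" where
  "tests_equality rep f \<longleftrightarrow>
     (\<forall>a b x y. rep a = Some x \<and> rep b = Some y \<longrightarrow> f (prod_encode (a, b)) = Some (of_bool (x = y)))"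

definition computable_field :: "real set \<Rightarrow> (nat \<rightharpoonup> real) \<Rightarrow> bool" where
  "computable_field K rep \<longleftrightarrow>
     subfield K (ring_of_type_algebra :: real ring) \<and>
     ran rep = K \<and>
     (\<exists>f. partial_recursive f \<and> computes_binary rep f (+)) \<and>
     (\<exists>f. partial_recursive f \<and> computes_binary rep f (*)) \<and>
     (\<exists>f. partial_recursive f \<and> computes_unary rep f uminus UNIV) \<and>
     (\<exists>f. partial_recursive f \<and> computes_unary rep f inverse (- {0})) \<and>
     (\<exists>f. partial_recursive f \<and> tests_equality rep f)"

abbreviation field_generated_by :: "real set \<Rightarrow> real set" where
  "field_generated_by S \<equiv> generate_field (ring_of_type_algebra :: real ring) S"

section \<open>Shifts of finite type and block codes\<close>

text \<open>
  Finite alphabets are finite sets of natural numbers, the index set of an \<open>n \<times> n\<close> matrix being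
  \<open>{..<n}\<close>.  The type \<^typ>\<open>int \<Rightarrow> nat\<close> carries the product of the discrete topologies, so that \<^const>\<open>borel\<close>
  is the usual Borel structure on sequences.
\<close>

definition shift :: "(int \<Rightarrow> nat) \<Rightarrow> (int \<Rightarrow> nat)" where
  "shift x = (\<lambda>i. x (i + 1))"

definition segment :: "(int \<Rightarrow> nat) \<Rightarrow> int \<Rightarrow> int \<Rightarrow> nat list" where
  "segment x a b = map x [a..b]"

definition subshift :: "(int \<Rightarrow> nat) set \<Rightarrow> bool" where
  "subshift Y \<longleftrightarrow> closed Y \<and> shift ` Y = Y \<and> (\<exists>S. finite S \<and> (\<forall>y\<in>Y. range y \<subseteq> S))"

definition zero_one_matrix :: "nat mat \<Rightarrow> bool" where
  "zero_one_matrix A \<longleftrightarrow> square_mat A \<and> elements_mat A \<subseteq> {0, 1}"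

definition irreducible_matrix :: "nat mat \<Rightarrow> bool" where
  "irreducible_matrix A \<longleftrightarrow> square_mat A \<and> dim_row A > 0 \<and>
     (\<forall>i<dim_row A. \<forall>j<dim_row A. \<exists>m>0. (A ^\<^sub>m m) $$ (i, j) > 0)"

definition shift_of_finite_type :: "nat mat \<Rightarrow> (int \<Rightarrow> nat) set" where
  "shift_of_finite_type A =
     {x. (\<forall>i. x i < dim_row A) \<and> (\<forall>i. A $$ (x i, x (i + 1)) = 1)}"

definition block_code :: "nat \<Rightarrow> nat \<Rightarrow> (nat list \<Rightarrow> nat) \<Rightarrow> (int \<Rightarrow> nat) \<Rightarrow> (int \<Rightarrow> nat)" where
  "block_code s t \<Phi> x = (\<lambda>i. \<Phi> (segment x (i - int s) (i + int t)))"

section \<open>Markov measures\<close>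

definition invariant_prob :: "(int \<Rightarrow> nat) set \<Rightarrow> (int \<Rightarrow> nat) measure \<Rightarrow> bool" where
  "invariant_prob Y \<nu> \<longleftrightarrow>
     prob_space \<nu> \<and> space \<nu> = Y \<and> sets \<nu> = sets (restrict_space borel Y) \<and>
     (\<forall>E\<in>sets \<nu>. measure \<nu> (shift -` E \<inter> space \<nu>) = measure \<nu> E)"

definition k_step_markov :: "nat \<Rightarrow> (int \<Rightarrow> nat) set \<Rightarrow> (int \<Rightarrow> nat) measure \<Rightarrow> bool" where
  "k_step_markov k Y \<nu> \<longleftrightarrow>
     subshift Y \<and> invariant_prob Y \<nu> \<and>
     (\<forall>i\<ge>0. \<forall>j\<ge>int k. \<forall>x\<in>Y.
        measure \<nu> {y \<in> space \<nu>. segment y (-j) (-1) = segment x (-j) (-1)} > 0 \<longrightarrow>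
        \<P>(y in \<nu>. segment y 0 i = segment x 0 i \<bar> segment y (-j) (-1) = segment x (-j) (-1)) =
        \<P>(y in \<nu>. segment y 0 i = segment x 0 i \<bar> segment y (-int k) (-1) = segment x (-int k) (-1)))"

definition is_markov :: "(int \<Rightarrow> nat) set \<Rightarrow> (int \<Rightarrow> nat) measure \<Rightarrow> bool" where
  "is_markov Y \<nu> \<longleftrightarrow> (\<exists>k\<ge>1. k_step_markov k Y \<nu>)"

definition stochastic_for :: "nat mat \<Rightarrow> real mat \<Rightarrow> bool" where
  "stochastic_for A P \<longleftrightarrow>
     P \<in> carrier_mat (dim_row A) (dim_col A) \<and>
     (\<forall>i<dim_row A. \<forall>j<dim_col A. P $$ (i, j) \<ge> 0 \<and> (P $$ (i, j) = 0 \<longleftrightarrow> A $$ (i, j) = 0)) \<and>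
     (\<forall>i<dim_row A. (\<Sum>j<dim_col A. P $$ (i, j)) = 1)"

text \<open>\<open>P\<^sup>T *\<^sub>v p = p\<close> says \<open>pP = p\<close> for the row vector \<open>p\<close>.\<close>

definition stationary_vector :: "real mat \<Rightarrow> real vec \<Rightarrow> bool" where
  "stationary_vector P p \<longleftrightarrow>
     p \<in> carrier_vec (dim_row P) \<and>
     (\<forall>i<dim_row P. p $ i \<ge> 0) \<and> (\<Sum>i<dim_row P. p $ i) = 1 \<and>
     P\<^sup>T *\<^sub>v p = p"

text \<open>
  For irreducible \<open>A\<close> the stationary vector is unique, so the existential quantifier picks the
  stationary vector of \<open>P\<close>; the formula then determines \<open>\<mu>\<close>.
\<close>

definition markov_measure :: "nat mat \<Rightarrow> real mat \<Rightarrow> (int \<Rightarrow> nat) measure \<Rightarrow> bool" where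
  "markov_measure A P \<mu> \<longleftrightarrow>
     stochastic_for A P \<and>
     invariant_prob (shift_of_finite_type A) \<mu> \<and>
     (\<exists>p. stationary_vector P p \<and>
        (\<forall>t a. length a = t + 1 \<and> set a \<subseteq> {..<dim_row A} \<longrightarrow>
           measure \<mu> {x \<in> space \<mu>. segment x 0 (int t) = a} =
             p $ (a ! 0) * (\<Prod>i<t. P $$ (a ! i, a ! (i + 1)))))"

definition image_measure ::
  "((int \<Rightarrow> nat) \<Rightarrow> (int \<Rightarrow> nat)) \<Rightarrow> (int \<Rightarrow> nat) measure \<Rightarrow> (int \<Rightarrow> nat) measure" where
  "image_measure \<phi> \<mu> = distr \<mu> (restrict_space borel (\<phi> ` space \<mu>)) \<phi>"

section \<open>The input of the decision algorithm\<close>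

definition mat_encode :: "nat mat \<Rightarrow> nat" where
  "mat_encode M = list_encode (map list_encode (mat_to_list M))"

text \<open>The block map is given by its finite table of values on all words of length \<open>s + t + 1\<close>.\<close>

definition block_map_encode :: "nat \<Rightarrow> nat \<Rightarrow> nat \<Rightarrow> (nat list \<Rightarrow> nat) \<Rightarrow> nat" where
  "block_map_encode n s t \<Phi> =
     list_encode (map (\<lambda>w. prod_encode (list_encode w, \<Phi> w)) (List.n_lists (s + t + 1) [0..<n]))"

definition represents_mat :: "(nat \<rightharpoonup> real) \<Rightarrow> nat mat \<Rightarrow> real mat \<Rightarrow> bool" where
  "represents_mat rep C P \<longleftrightarrow> map_mat rep C = map_mat Some P"

text \<open>\<open>C\<close> is a matrix of codes for the entries of the stochastic matrix.\<close>

definition input_encode :: "nat mat \<Rightarrow> nat mat \<Rightarrow> nat \<Rightarrow> nat \<Rightarrow> (nat list \<Rightarrow> nat) \<Rightarrow> nat" where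
  "input_encode A C s t \<Phi> =
     list_encode [mat_encode A, mat_encode C, s, t, block_map_encode (dim_row A) s t \<Phi>]"

end

theory Submission
  imports Defs
begin

text \<open>
  Call the words over the alphabet of \<open>\<Omega>\<^sub>A\<close> of length \<open>s + t + 1\<close> windows, and let \<open>N\<close> be the number of
  windows.  Reading a point of \<open>\<Omega>\<^sub>A\<close> window by window turns the image measure into the behaviour of
  a weighted automaton: the probability of a word \<open>w\<close> is \<open>\<nu>(w) = \<pi> M\<^sub>w \<eta>\<close>, where \<open>M\<^sub>w\<close> is a product of
  \<open>N \<times> N\<close> matrices, one for each letter of \<open>w\<close> (\<open>word_weight_automaton\<close>, \<open>measure_image_cylinder\<close>).

  The image is \<open>k\<close>-step Markov iff \<open>\<nu>(wuv) \<nu>(u) = \<nu>(wu) \<nu>(uv)\<close> whenever \<open>u\<close> has length \<open>k\<close>, that is,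
  iff for each such \<open>u\<close> the infinite matrix \<open>\<nu>(wuv)\<close>, indexed by the contexts \<open>w\<close> and \<open>v\<close>, has rank at
  most one (\<open>k_step_markov_iff_splits\<close>).  The vanishing of the \<open>2 \<times> 2\<close> minors of this matrix says that
  the word \<open>u\<close>, acting on \<open>\<real>\<^sup>N \<otimes> \<real>\<^sup>N\<close>, sends certain vectors into a certain subspace.  The vectors which
  are sent there by all words of length \<open>j\<close> form subspaces which increase with \<open>j\<close>, and as soon as two
  successive ones agree all later ones agree as well.  So nothing changes after \<open>j = N\<^sup>2\<close>: if the image
  is Markov of some order, it is Markov of order \<open>N\<^sup>2\<close> (\<open>splits_at_long_words\<close>).  The same
  argument, in \<open>\<real>\<^sup>N\<close>, shows that contexts of length at most \<open>N\<close> are enough to detect a failure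
  (\<open>splits_at_if_splits_short_contexts\<close>).  What remains is a finite set of equations between sums
  of products of entries of \<open>P\<close> and of the stationary vector.

  These equations are homogeneous of degree two in the stationary vector, so every nonzero multiple
  of that vector serves as well.  By irreducibility these multiples are all the solutions of
  \<open>qP = q\<close> (\<open>fixed_vector_unique\<close>), and elimination without divisions shows that there is a
  nonzero solution whose components are integer polynomials in the entries of \<open>P\<close>
  (\<open>fixed_vector_signed_sum\<close>).  The algorithm searches for such polynomials, whose values can be computed
  without ever leaving the representable numbers, and then evaluates the finite set of equations.
  It only adds, multiplies and tests equality.
\<close>

section \<open>Recursive functions of codes\<close>

text \<open>
  The closure properties below have the form "if the parts are recursive in the environment \<open>e\<close>,
  so is the compound".  A bound variable is pushed onto the environment by pairing, so that a term
  built from known functions is shown to be recursive by repeated introduction.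
\<close>

definition fst_code :: "nat \<Rightarrow> nat" where
  "fst_code z = fst (prod_decode z)"

definition snd_code :: "nat \<Rightarrow> nat" where
  "snd_code z = snd (prod_decode z)"

lemma fst_code_pair [simp]: "fst_code (prod_encode (a, b)) = a"
  by (simp add: fst_code_def)

lemma snd_code_pair [simp]: "snd_code (prod_encode (a, b)) = b"
  by (simp add: snd_code_def)

lemma pair_codes [simp]: "prod_encode (fst_code z, snd_code z) = z"
  by (simp add: fst_code_def snd_code_def)

definition recursive :: "(nat \<Rightarrow> nat) \<Rightarrow> bool" where
  "recursive f \<longleftrightarrow> partial_recursive (\<lambda>e. Some (f e))"

definition decidable :: "(nat \<Rightarrow> bool) \<Rightarrow> bool" where
  "decidable P \<longleftrightarrow> recursive (\<lambda>e. of_bool (P e))"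

lemma recursive_pair:
  assumes "recursive f" "recursive g"
  shows "recursive (\<lambda>e. prod_encode (f e, g e))"
  using partial_recursive.pair [OF assms [unfolded recursive_def]] by (simp add: recursive_def)

lemma recursive_compose: "recursive f \<Longrightarrow> recursive g \<Longrightarrow> recursive (\<lambda>e. f (g e))"
  unfolding recursive_def using partial_recursive.comp by fastforce

lemma recursive_fst: "recursive f \<Longrightarrow> recursive (\<lambda>e. fst_code (f e))"
  using recursive_compose [of "\<lambda>x. fst_code x"] partial_recursive.left
  by (simp add: recursive_def fst_code_def)

lemma recursive_snd: "recursive f \<Longrightarrow> recursive (\<lambda>e. snd_code (f e))"
  using recursive_compose [of "\<lambda>x. snd_code x"] partial_recursive.right
  by (simp add: recursive_def snd_code_def)

lemma recursive_Suc: "recursive f \<Longrightarrow> recursive (\<lambda>e. Suc (f e))"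
  using recursive_compose [of Suc] partial_recursive.succ by (simp add: recursive_def)

lemma recursive_id: "recursive (\<lambda>e. e)"
proof -
  have "recursive (\<lambda>e. prod_encode (fst_code e, snd_code e))"
    using partial_recursive.left partial_recursive.right
    by (intro recursive_pair) (simp_all add: recursive_def fst_code_def snd_code_def)
  then show ?thesis by simp
qed

lemma recursive_const: "recursive (\<lambda>e. c)"
proof (induction c)
  case 0
  show ?case using partial_recursive.zero by (simp add: recursive_def)
next
  case (Suc c)
  then show ?case by (rule recursive_Suc)
qed

text \<open>
  The step function may depend on the environment; it finds the environment, the counter and the
  previous value in this order in its argument.
\<close>

lemma recursive_rec_nat:
  assumes f: "recursive f" and m: "recursive m"
    and h: "recursive (\<lambda>z. h (fst_code z) (fst_code (snd_code z)) (snd_code (snd_code z)))"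
  shows "recursive (\<lambda>e. rec_nat (f e) (\<lambda>k v. h e k v) (m e))"
proof -
  let ?g = "\<lambda>z. h (fst_code z) (fst_code (snd_code z)) (snd_code (snd_code z))"
  have step: "rec_nat (Some (f a)) (\<lambda>k r. Option.bind r (\<lambda>v. Some (?g (prod_encode (a, prod_encode (k, v)))))) m
      = Some (rec_nat (f a) (\<lambda>k v. h a k v) m)" for a m
    by (induction m) auto
  have "recursive (\<lambda>z. rec_nat (f (fst_code z)) (\<lambda>k v. h (fst_code z) k v) (snd_code z))"
    using partial_recursive.prec [OF f [unfolded recursive_def] h [unfolded recursive_def]]
    unfolding step by (simp add: recursive_def fst_code_def snd_code_def case_prod_beta)
  from recursive_compose [OF this recursive_pair [OF recursive_id m]]
  show ?thesis by simp
qed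

lemmas recursive_basic = recursive_const recursive_id recursive_fst recursive_snd recursive_pair
  recursive_Suc recursive_rec_nat

subsection \<open>Arithmetic\<close>

lemma recursive_add:
  assumes "recursive f" "recursive g"
  shows "recursive (\<lambda>e. f e + g e)"
proof -
  have *: "a + b = rec_nat a (\<lambda>_ v. Suc v) b" for a b :: nat
    by (induction b) auto
  show ?thesis unfolding * by (intro recursive_basic assms)
qed

lemma recursive_mult:
  assumes "recursive f" "recursive g"
  shows "recursive (\<lambda>e. f e * g e)"
proof -
  have *: "a * b = rec_nat 0 (\<lambda>_ v. v + a) b" for a b :: nat
    by (induction b) auto
  show ?thesis
    unfolding * by (intro recursive_basic recursive_add recursive_compose [OF assms(1)] assms)
qed

lemma recursive_diff:
  assumes "recursive f" "recursive g"
  shows "recursive (\<lambda>e. f e - g e)"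
proof -
  have pred: "v - 1 = rec_nat 0 (\<lambda>k _. k) v" for v :: nat
    by (cases v) auto
  have *: "a - b = rec_nat a (\<lambda>_ v. rec_nat 0 (\<lambda>k _. k) v) b" for a b :: nat
    by (induction b) (auto simp flip: pred)
  show ?thesis unfolding * by (intro recursive_basic assms)
qed

lemma recursive_power:
  assumes "recursive f" "recursive g"
  shows "recursive (\<lambda>e. f e ^ g e)"
proof -
  have *: "a ^ b = rec_nat 1 (\<lambda>_ v. v * a) b" for a b :: nat
    by (induction b) auto
  show ?thesis
    unfolding * by (intro recursive_basic recursive_mult recursive_compose [OF assms(1)] assms)
qed

lemmas recursive_arith = recursive_basic recursive_add recursive_mult recursive_diff recursive_power

subsection \<open>Decidable conditions\<close>

lemma decidable_not: "decidable P \<Longrightarrow> decidable (\<lambda>e. \<not> P e)"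
proof -
  assume P: "decidable P"
  have *: "of_bool (\<not> p) = (1 - of_bool p :: nat)" for p
    by simp
  show ?thesis
    using P unfolding decidable_def * by (intro recursive_arith)
qed

lemma decidable_conj: "decidable P \<Longrightarrow> decidable Q \<Longrightarrow> decidable (\<lambda>e. P e \<and> Q e)"
  unfolding decidable_def of_bool_conj by (intro recursive_arith)

lemma decidable_disj: "decidable P \<Longrightarrow> decidable Q \<Longrightarrow> decidable (\<lambda>e. P e \<or> Q e)"
  using decidable_not [OF decidable_conj [OF decidable_not decidable_not, of P Q]] by simp

lemma decidable_imp: "decidable P \<Longrightarrow> decidable Q \<Longrightarrow> decidable (\<lambda>e. P e \<longrightarrow> Q e)"
  unfolding imp_conv_disj by (intro decidable_disj decidable_not)

lemma decidable_le:
  assumes "recursive f" "recursive g"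
  shows "decidable (\<lambda>e. f e \<le> g e)"
proof -
  have *: "of_bool (a \<le> b) = 1 - (a - b)" for a b :: nat
    by (auto simp: of_bool_def)
  show ?thesis
    unfolding decidable_def * by (intro recursive_arith assms)
qed

lemma decidable_less:
  assumes "recursive f" "recursive g"
  shows "decidable (\<lambda>e. f e < g e)"
  unfolding not_le [symmetric] by (intro decidable_not decidable_le assms)

lemma decidable_eq:
  assumes "recursive f" "recursive g"
  shows "decidable (\<lambda>e. f e = g e)"
  unfolding order_eq_iff [of "f _"] by (intro decidable_conj decidable_le assms)

lemma decidable_ball_less:
  assumes "recursive b" "decidable (\<lambda>z. P (fst_code z) (snd_code z))"
  shows "decidable (\<lambda>e. \<forall>k<b e. P e k)"
proof -
  have "rec_nat 1 (\<lambda>k v. of_bool (P e k) * v) b = (of_bool (\<forall>k<b. P e k) :: nat)" for e b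
    by (induction b) (auto simp: less_Suc_eq)
  moreover have "recursive (\<lambda>z. of_bool (P (fst_code z) (fst_code (snd_code z))))"
    using recursive_compose [OF assms(2) [unfolded decidable_def]
        recursive_pair [OF recursive_fst [OF recursive_id]
          recursive_fst [OF recursive_snd [OF recursive_id]]]] by simp
  then have "recursive (\<lambda>e. rec_nat 1 (\<lambda>k v. of_bool (P e k) * v) (b e))"
    by (intro recursive_arith assms(1))
  ultimately show ?thesis by (simp add: decidable_def)
qed

lemma decidable_bex_less:
  assumes "recursive b" "decidable (\<lambda>z. P (fst_code z) (snd_code z))"
  shows "decidable (\<lambda>e. \<exists>k<b e. P e k)"
  using decidable_not [OF decidable_ball_less [OF assms(1) decidable_not [OF assms(2)]]] by simp

lemma recursive_Least:
  assumes P: "decidable (\<lambda>z. P (fst_code z) (snd_code z))" and ex: "\<And>e. \<exists>k. P e k"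
  shows "recursive (\<lambda>e. LEAST k. P e k)"
proof -
  have "partial_recursive (\<lambda>z. Some (of_bool (\<not> P (fst_code z) (snd_code z))))"
    using decidable_not [OF P] by (simp add: decidable_def recursive_def)
  from partial_recursive.mini [OF this] show ?thesis
    using ex by (simp add: recursive_def)
qed

text \<open>
  Both branches are total, so the choice can be made by arithmetic after evaluating both.
\<close>

lemma recursive_if:
  assumes "decidable P" "recursive f" "recursive g"
  shows "recursive (\<lambda>e. if P e then f e else g e)"
proof -
  have *: "(if P e then f e else g e) = of_bool (P e) * f e + (1 - of_bool (P e)) * g e" for e
    by simp
  show ?thesis
    unfolding * using assms unfolding decidable_def by (intro recursive_arith)
qed

lemma decidable_compose: "decidable P \<Longrightarrow> recursive g \<Longrightarrow> decidable (\<lambda>e. P (g e))"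
  unfolding decidable_def by (rule recursive_compose)

lemmas decidable_basic = decidable_not decidable_conj decidable_disj decidable_imp
  decidable_le decidable_less decidable_eq decidable_ball_less decidable_bex_less

subsection \<open>Words as numbers\<close>

text \<open>
  As \<^const>\<open>list_encode\<close> is a bijection, every number codes exactly one word: a quantifier or a sum over
  words is one over numbers.  Reading beyond the end of a word gives 0.
\<close>

definition suffix_code :: "nat \<Rightarrow> nat \<Rightarrow> nat" where
  "suffix_code c i = list_encode (drop i (list_decode c))"

definition entry :: "nat \<Rightarrow> nat \<Rightarrow> nat" where
  "entry c i = (if i < length (list_decode c) then list_decode c ! i else 0)"

definition word_length :: "nat \<Rightarrow> nat" where
  "word_length c = length (list_decode c)"

lemma prod_decode_zero [simp]: "prod_decode 0 = (0, 0)"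
  using prod_encode_inverse [of "(0, 0)"] by (simp add: prod_encode_def)

lemma snd_code_pred_list_encode: "snd_code (list_encode xs - 1) = list_encode (tl xs)"
  by (cases xs) (auto simp: snd_code_def)

lemma fst_code_pred_list_encode: "fst_code (list_encode xs - 1) = (if xs = [] then 0 else hd xs)"
  by (cases xs) (auto simp: fst_code_def)

lemma recursive_suffix_code:
  assumes "recursive f" "recursive g"
  shows "recursive (\<lambda>e. suffix_code (f e) (g e))"
proof -
  have *: "suffix_code c i = rec_nat c (\<lambda>_ v. snd_code (v - 1)) i" for c i
  proof (induction i)
    case 0
    show ?case by (simp add: suffix_code_def)
  next
    case (Suc i)
    have "suffix_code c (Suc i) = snd_code (suffix_code c i - 1)"
      unfolding suffix_code_def snd_code_pred_list_encode by (simp add: drop_Suc tl_drop)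
    also have "\<dots> = rec_nat c (\<lambda>_ v. snd_code (v - 1)) (Suc i)"
      unfolding Suc by simp
    finally show ?case .
  qed
  show ?thesis unfolding * by (intro recursive_arith assms)
qed

lemma recursive_entry:
  assumes "recursive f" "recursive g"
  shows "recursive (\<lambda>e. entry (f e) (g e))"
proof -
  have *: "entry c i = fst_code (suffix_code c i - 1)" for c i
    unfolding entry_def suffix_code_def fst_code_pred_list_encode by (simp add: hd_drop_conv_nth)
  show ?thesis unfolding * by (intro recursive_arith recursive_suffix_code assms)
qed

lemma recursive_word_length:
  assumes "recursive f"
  shows "recursive (\<lambda>e. word_length (f e))"
proof -
  have *: "suffix_code c i = 0 \<longleftrightarrow> length (list_decode c) \<le> i" for c i
    using list_encode_eq [of _ "[]"] by (simp add: suffix_code_def)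
  have "word_length c = (LEAST i. suffix_code c i = 0)" for c
    unfolding * by (rule sym, rule Least_equality) (auto simp: word_length_def)
  moreover have "recursive (\<lambda>c. LEAST i. suffix_code c i = 0)"
    by (intro recursive_Least decidable_eq recursive_arith recursive_suffix_code) (use * in blast)
  ultimately show ?thesis using recursive_compose [OF _ assms] by simp
qed

text \<open>
  \<open>word_bound a l\<close> exceeds the codes of all words of length at most \<open>l\<close> over \<open>{..a}\<close>.
\<close>

fun word_bound :: "nat \<Rightarrow> nat \<Rightarrow> nat" where
  "word_bound a 0 = 1"
| "word_bound a (Suc l) = Suc (Suc (prod_encode (a, word_bound a l)))"

lemma prod_encode_mono: "a \<le> a' \<Longrightarrow> b \<le> b' \<Longrightarrow> prod_encode (a, b) \<le> prod_encode (a', b')"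
  unfolding prod_encode_def triangle_def
  by (auto intro!: add_mono div_le_mono mult_le_mono)

lemma list_encode_less_word_bound:
  assumes "\<forall>b\<in>set w. b \<le> a" "length w \<le> l"
  shows "list_encode w < word_bound a l"
  using assms
proof (induction w arbitrary: l)
  case Nil
  then show ?case by (cases l) auto
next
  case (Cons b w)
  then obtain l' where [simp]: "l = Suc l'" by (cases l) auto
  have "list_encode w < word_bound a l'" using Cons by auto
  then have "prod_encode (b, list_encode w) \<le> prod_encode (a, word_bound a l')"
    using Cons.prems by (intro prod_encode_mono) auto
  then show ?case by simp
qed

lemma recursive_word_bound:
  assumes "recursive f" "recursive g"
  shows "recursive (\<lambda>e. word_bound (f e) (g e))"
proof -
  have *: "word_bound a l = rec_nat 1 (\<lambda>_ v. Suc (Suc (prod_encode (a, v)))) l" for a l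
    by (induction l) auto
  show ?thesis
    unfolding * by (intro recursive_basic recursive_compose [OF assms(1)] assms)
qed

lemmas recursive_rules = recursive_arith recursive_suffix_code recursive_entry
  recursive_word_length recursive_word_bound recursive_if

section \<open>Computing with real numbers given by codes\<close>

text \<open>
  Real-valued functions are computed through codes, and only on arguments in a domain \<open>D\<close>: a program
  for field arithmetic may diverge on numbers which are not codes.
\<close>

definition real_computable :: "(nat \<rightharpoonup> real) \<Rightarrow> (nat \<Rightarrow> bool) \<Rightarrow> (nat \<Rightarrow> real) \<Rightarrow> bool" where
  "real_computable rep D f \<longleftrightarrow>
     (\<exists>F. partial_recursive F \<and> (\<forall>e. D e \<longrightarrow> (\<exists>c. F e = Some c \<and> rep c = Some (f e))))"

definition decidable_on :: "(nat \<Rightarrow> bool) \<Rightarrow> (nat \<Rightarrow> bool) \<Rightarrow> bool" where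
  "decidable_on D P \<longleftrightarrow>
     (\<exists>F. partial_recursive F \<and> (\<forall>e. D e \<longrightarrow> F e = Some (of_bool (P e))))"

lemma decidable_imp_decidable_on: "decidable P \<Longrightarrow> decidable_on D P"
  unfolding decidable_def decidable_on_def recursive_def by blast

lemma partial_recursive_substitute:
  "partial_recursive F \<Longrightarrow> recursive g \<Longrightarrow> partial_recursive (\<lambda>e. F (g e))"
  unfolding recursive_def using partial_recursive.comp by fastforce

lemma partial_recursive_bind2:
  assumes F: "partial_recursive F" and G: "partial_recursive G" and H: "partial_recursive H"
  shows "partial_recursive
    (\<lambda>e. Option.bind (G e) (\<lambda>u. Option.bind (H e) (\<lambda>v. F (prod_encode (u, v)))))"
proof -
  have "Option.bind (Option.bind (G e) (\<lambda>u. Option.bind (H e) (\<lambda>v. Some (prod_encode (u, v))))) F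
    = Option.bind (G e) (\<lambda>u. Option.bind (H e) (\<lambda>v. F (prod_encode (u, v))))" for e
    by (cases "G e"; cases "H e") auto
  then show ?thesis
    using partial_recursive.comp [OF F partial_recursive.pair [OF G H]] by simp
qed

text \<open>
  The loop behind finite sums, products and bounded quantifiers: \<open>T\<close> yields the successive items
  and \<open>F\<close> combines them.
\<close>

lemma partial_recursive_fold:
  assumes F: "partial_recursive F" and T: "partial_recursive T" and b: "recursive b"
  shows "partial_recursive (\<lambda>e. rec_nat (Some c)
    (\<lambda>k r. Option.bind r (\<lambda>v. Option.bind (T (prod_encode (e, k))) (\<lambda>t. F (prod_encode (v, t))))) (b e))"
proof -
  let ?g = "\<lambda>z. Option.bind (Some (snd_code (snd_code z))) (\<lambda>v.
    Option.bind (T (prod_encode (fst_code z, fst_code (snd_code z)))) (\<lambda>t. F (prod_encode (v, t))))"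
  have 1: "partial_recursive ?g"
    by (intro partial_recursive_bind2 F partial_recursive_substitute [OF T])
      (use recursive_snd [OF recursive_snd [OF recursive_id]] in \<open>simp add: recursive_def\<close>,
       intro recursive_basic)
  have 2: "partial_recursive (\<lambda>e. Some c)"
    using recursive_const by (simp add: recursive_def)
  from partial_recursive_substitute [OF partial_recursive.prec [OF 2 1]
      recursive_pair [OF recursive_id b]]
  show ?thesis by simp
qed

text \<open>
  All intermediate results of the loop are again codes, which is what keeps \<open>F\<close> within the arguments
  on which its behaviour is known.
\<close>

lemma rec_nat_fold_computes:
  assumes F: "computes_binary rep F op" and c: "rep c = Some u"
    and T: "\<And>k. k < m \<Longrightarrow> \<exists>c. T k = Some c \<and> rep c = Some (t k)"
  shows "\<exists>c'. rec_nat (Some c) (\<lambda>k r. Option.bind r (\<lambda>v. Option.bind (T k) (\<lambda>t. F (prod_encode (v, t))))) m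
      = Some c' \<and> rep c' = Some (rec_nat u (\<lambda>k v. op v (t k)) m)"
  using T
proof (induction m)
  case 0
  then show ?case using c by simp
next
  case (Suc m)
  then obtain c1 where
    c1: "rec_nat (Some c) (\<lambda>k r. Option.bind r (\<lambda>v. Option.bind (T k) (\<lambda>t. F (prod_encode (v, t))))) m
      = Some c1" "rep c1 = Some (rec_nat u (\<lambda>k v. op v (t k)) m)"
    by (meson less_Suc_eq)
  from Suc.prems [of m] obtain c2 where "T m = Some c2" "rep c2 = Some (t m)" by auto
  with c1 F show ?case by (fastforce simp: computes_binary_def)
qed

locale real_codes =
  fixes K :: "real set" and rep :: "nat \<rightharpoonup> real"
  assumes field: "computable_field K rep"
begin

abbreviation computable :: "(nat \<Rightarrow> bool) \<Rightarrow> (nat \<Rightarrow> real) \<Rightarrow> bool" where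
  "computable \<equiv> real_computable rep"

lemma computable_const:
  assumes "x \<in> K"
  shows "computable D (\<lambda>e. x)"
proof -
  obtain c where "rep c = Some x"
    using field assms unfolding computable_field_def ran_def by auto
  then show ?thesis
    using recursive_const [of c] unfolding real_computable_def recursive_def by blast
qed

lemma computable_code:
  assumes "recursive g" "\<And>e. D e \<Longrightarrow> rep (g e) = Some (f e)"
  shows "computable D f"
  using assms unfolding real_computable_def recursive_def by fastforce

lemma computable_binary:
  assumes F: "partial_recursive F" "computes_binary rep F op"
    and f: "computable D f" and g: "computable D g"
  shows "computable D (\<lambda>e. op (f e) (g e))"
proof -
  from f obtain G where G: "partial_recursive G"
    "\<And>e. D e \<Longrightarrow> \<exists>c. G e = Some c \<and> rep c = Some (f e)"
    unfolding real_computable_def by blast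
  from g obtain H where H: "partial_recursive H"
    "\<And>e. D e \<Longrightarrow> \<exists>c. H e = Some c \<and> rep c = Some (g e)"
    unfolding real_computable_def by blast
  show ?thesis
    unfolding real_computable_def
  proof (rule exI, intro conjI allI impI)
    show "partial_recursive
      (\<lambda>e. Option.bind (G e) (\<lambda>u. Option.bind (H e) (\<lambda>v. F (prod_encode (u, v)))))"
      by (rule partial_recursive_bind2 [OF F(1) G(1) H(1)])
  next
    fix e assume "D e"
    with G(2) [of e] H(2) [of e] F(2)
    show "\<exists>c. Option.bind (G e) (\<lambda>u. Option.bind (H e) (\<lambda>v. F (prod_encode (u, v)))) = Some c
        \<and> rep c = Some (op (f e) (g e))"
      by (fastforce simp: computes_binary_def)
  qed
qed

lemma computable_fold:
  assumes F: "partial_recursive F" "computes_binary rep F op" and u: "u \<in> K"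
    and b: "recursive b" and t: "computable (\<lambda>z. D (fst_code z)) (\<lambda>z. t (fst_code z) (snd_code z))"
  shows "computable D (\<lambda>e. rec_nat u (\<lambda>k v. op v (t e k)) (b e))"
proof -
  obtain c where c: "rep c = Some u"
    using field u unfolding computable_field_def ran_def by auto
  from t obtain T where T: "partial_recursive T"
    "\<And>z. D (fst_code z) \<Longrightarrow> \<exists>c. T z = Some c \<and> rep c = Some (t (fst_code z) (snd_code z))"
    unfolding real_computable_def by blast
  show ?thesis
    unfolding real_computable_def
  proof (rule exI, intro conjI allI impI)
    show "partial_recursive (\<lambda>e. rec_nat (Some c)
      (\<lambda>k r. Option.bind r (\<lambda>v. Option.bind (T (prod_encode (e, k))) (\<lambda>t. F (prod_encode (v, t))))) (b e))"
      by (rule partial_recursive_fold [OF F(1) T(1) b])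
  next
    fix e assume "D e"
    then show "\<exists>c'. rec_nat (Some c)
      (\<lambda>k r. Option.bind r (\<lambda>v. Option.bind (T (prod_encode (e, k))) (\<lambda>t. F (prod_encode (v, t))))) (b e)
      = Some c' \<and> rep c' = Some (rec_nat u (\<lambda>k v. op v (t e k)) (b e))"
      using T(2) [of "prod_encode (e, _)"]
      by (intro rec_nat_fold_computes [where T = "\<lambda>k. T (prod_encode (e, k))"] F c) auto
  qed
qed

lemma zero_in_K: "0 \<in> K" and one_in_K: "1 \<in> K" and minus_one_in_K: "- 1 \<in> K"
proof -
  have K: "ran rep = K" and "subfield K (ring_of_type_algebra :: real ring)"
    using field by (auto simp: computable_field_def)
  then have "subcring K (ring_of_type_algebra :: real ring)"
    by (simp add: subfield_def subdomain_def)
  then have sub: "subring K (ring_of_type_algebra :: real ring)"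
    by (simp add: subcring_def)
  show one: "1 \<in> K"
    using subringE(3) [OF sub] by (simp add: ring_of_type_algebra_def)
  show "0 \<in> K"
    using subringE(2) [OF sub] by (simp add: ring_of_type_algebra_def)
  obtain f where f: "computes_unary rep f uminus UNIV"
    using field by (auto simp: computable_field_def)
  obtain c where "rep c = Some 1"
    using one K by (auto simp: ran_def)
  with f have "\<exists>c. rep c = Some (- 1)"
    unfolding computes_unary_def by blast
  with K show "- 1 \<in> K" by (auto simp: ran_def)
qed

lemma computable_mult:
  assumes "computable D f" "computable D g"
  shows "computable D (\<lambda>e. f e * g e)"
  using field computable_binary assms unfolding computable_field_def by blast

lemma computable_sum:
  assumes b: "recursive b" and t: "computable (\<lambda>z. D (fst_code z)) (\<lambda>z. t (fst_code z) (snd_code z))"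
  shows "computable D (\<lambda>e. \<Sum>k<b e. t e k)"
proof -
  obtain F where F: "partial_recursive F" "computes_binary rep F (+)"
    using field by (auto simp: computable_field_def)
  have "rec_nat 0 (\<lambda>k v. v + t e k) m = (\<Sum>k<m. t e k)" for e m
    by (induction m) auto
  with computable_fold [OF F zero_in_K b t] show ?thesis by simp
qed

lemma computable_prod:
  assumes b: "recursive b" and t: "computable (\<lambda>z. D (fst_code z)) (\<lambda>z. t (fst_code z) (snd_code z))"
  shows "computable D (\<lambda>e. \<Prod>k<b e. t e k)"
proof -
  obtain F where F: "partial_recursive F" "computes_binary rep F (*)"
    using field by (auto simp: computable_field_def)
  have "rec_nat 1 (\<lambda>k v. v * t e k) m = (\<Prod>k<m. t e k)" for e m
    by (induction m) auto
  with computable_fold [OF F one_in_K b t] show ?thesis by simp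
qed

lemma computable_if:
  assumes P: "decidable P" and f: "computable D f" and g: "computable D g"
  shows "computable D (\<lambda>e. if P e then f e else g e)"
proof -
  from f obtain G where G: "partial_recursive G"
    "\<And>e. D e \<Longrightarrow> \<exists>c. G e = Some c \<and> rep c = Some (f e)"
    unfolding real_computable_def by blast
  from g obtain H where H: "partial_recursive H"
    "\<And>e. D e \<Longrightarrow> \<exists>c. H e = Some c \<and> rep c = Some (g e)"
    unfolding real_computable_def by blast
  let ?S = "\<lambda>z. if P (fst_code z) then fst_code (snd_code z) else snd_code (snd_code z)"
  have S: "partial_recursive (\<lambda>z. Some (?S z))"
    using recursive_if [OF decidable_compose [OF P]] recursive_basic by (simp add: recursive_def)
  let ?GH = "\<lambda>e. Option.bind (G e) (\<lambda>u. Option.bind (H e) (\<lambda>v. Some (prod_encode (u, v))))"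
  have id: "partial_recursive (\<lambda>e. Some e)"
    using recursive_id by (simp add: recursive_def)
  show ?thesis
    unfolding real_computable_def
  proof (rule exI, intro conjI allI impI)
    show "partial_recursive (\<lambda>e. Option.bind (Some e) (\<lambda>x.
      Option.bind (?GH e) (\<lambda>v. Some (?S (prod_encode (x, v))))))"
      by (rule partial_recursive_bind2 [OF S id partial_recursive.pair [OF G(1) H(1)]])
  next
    fix e assume "D e"
    with G(2) [of e] H(2) [of e]
    show "\<exists>c. Option.bind (Some e) (\<lambda>x. Option.bind (?GH e) (\<lambda>v. Some (?S (prod_encode (x, v))))) = Some c
        \<and> rep c = Some (if P e then f e else g e)"
      by auto
  qed
qed

lemma decidable_on_eq:
  assumes f: "computable D f" and g: "computable D g"
  shows "decidable_on D (\<lambda>e. f e = g e)"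
proof -
  from field obtain E where E: "partial_recursive E" "tests_equality rep E"
    by (auto simp: computable_field_def)
  from f obtain G where G: "partial_recursive G"
    "\<And>e. D e \<Longrightarrow> \<exists>c. G e = Some c \<and> rep c = Some (f e)"
    unfolding real_computable_def by blast
  from g obtain H where H: "partial_recursive H"
    "\<And>e. D e \<Longrightarrow> \<exists>c. H e = Some c \<and> rep c = Some (g e)"
    unfolding real_computable_def by blast
  show ?thesis
    unfolding decidable_on_def
  proof (rule exI, intro conjI allI impI)
    show "partial_recursive
      (\<lambda>e. Option.bind (G e) (\<lambda>u. Option.bind (H e) (\<lambda>v. E (prod_encode (u, v)))))"
      by (rule partial_recursive_bind2 [OF E(1) G(1) H(1)])
  next
    fix e assume "D e"
    with G(2) [of e] H(2) [of e] E(2)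
    show "Option.bind (G e) (\<lambda>u. Option.bind (H e) (\<lambda>v. E (prod_encode (u, v))))
        = Some (of_bool (f e = g e))"
      by (fastforce simp: tests_equality_def)
  qed
qed

lemma decidable_on_binary:
  assumes P: "decidable_on D P" and Q: "decidable_on D Q"
    and F: "recursive (\<lambda>z. F (fst_code z) (snd_code z))"
    and op: "\<And>p q. F (of_bool p) (of_bool q) = of_bool (op p q)"
  shows "decidable_on D (\<lambda>e. op (P e) (Q e))"
proof -
  from P obtain G where G: "partial_recursive G" "\<And>e. D e \<Longrightarrow> G e = Some (of_bool (P e))"
    unfolding decidable_on_def by blast
  from Q obtain H where H: "partial_recursive H" "\<And>e. D e \<Longrightarrow> H e = Some (of_bool (Q e))"
    unfolding decidable_on_def by blast
  show ?thesis
    unfolding decidable_on_def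
  proof (rule exI, intro conjI allI impI)
    show "partial_recursive (\<lambda>e. Option.bind (G e) (\<lambda>u. Option.bind (H e) (\<lambda>v.
        Some (F (fst_code (prod_encode (u, v))) (snd_code (prod_encode (u, v)))))))"
      by (rule partial_recursive_bind2 [OF F [unfolded recursive_def] G(1) H(1)])
  next
    fix e assume "D e"
    with G(2) [of e] H(2) [of e]
    show "Option.bind (G e) (\<lambda>u. Option.bind (H e) (\<lambda>v.
        Some (F (fst_code (prod_encode (u, v))) (snd_code (prod_encode (u, v))))))
        = Some (of_bool (op (P e) (Q e)))"
      by (simp add: op)
  qed
qed

lemma decidable_on_conj:
  assumes "decidable_on D P" "decidable_on D Q"
  shows "decidable_on D (\<lambda>e. P e \<and> Q e)"
  by (rule decidable_on_binary [OF assms, where F = "(*)"]) (intro recursive_arith, auto)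

lemma decidable_on_imp:
  assumes "decidable_on D P" "decidable_on D Q"
  shows "decidable_on D (\<lambda>e. P e \<longrightarrow> Q e)"
  by (rule decidable_on_binary [OF assms, where F = "\<lambda>p q. 1 - p * (1 - q)"])
    (intro recursive_arith, auto)

lemma decidable_on_not:
  assumes "decidable_on D P"
  shows "decidable_on D (\<lambda>e. \<not> P e)"
  by (rule decidable_on_binary [OF assms assms, where F = "\<lambda>p q. 1 - p"])
    (intro recursive_arith, auto)

lemma decidable_on_ball_less:
  assumes b: "recursive b" and P: "decidable_on (\<lambda>z. D (fst_code z)) (\<lambda>z. P (fst_code z) (snd_code z))"
  shows "decidable_on D (\<lambda>e. \<forall>k<b e. P e k)"
proof -
  from P obtain T where T: "partial_recursive T"
    "\<And>z. D (fst_code z) \<Longrightarrow> T z = Some (of_bool (P (fst_code z) (snd_code z)))"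
    unfolding decidable_on_def by blast
  have times: "partial_recursive (\<lambda>z. Some (fst_code z * snd_code z))"
    using recursive_mult [OF recursive_fst [OF recursive_id] recursive_snd [OF recursive_id]]
    by (simp add: recursive_def)
  let ?F = "\<lambda>e m. rec_nat (Some 1) (\<lambda>k r. Option.bind r (\<lambda>v. Option.bind (T (prod_encode (e, k)))
    (\<lambda>t. Some (fst_code (prod_encode (v, t)) * snd_code (prod_encode (v, t)))))) m"
  have "?F e m = Some (of_bool (\<forall>k<m. P e k))" if "D e" for e m
    using that T(2) [of "prod_encode (e, _)"] by (induction m) (auto simp: less_Suc_eq)
  with partial_recursive_fold [OF times T(1) b, of 1] show ?thesis
    unfolding decidable_on_def by (intro exI [of _ "\<lambda>e. ?F e (b e)"]) auto
qed

lemma decidable_on_bex_less: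
  assumes b: "recursive b" and P: "decidable_on (\<lambda>z. D (fst_code z)) (\<lambda>z. P (fst_code z) (snd_code z))"
  shows "decidable_on D (\<lambda>e. \<exists>k<b e. P e k)"
  using decidable_on_not [OF decidable_on_ball_less [OF b decidable_on_not [OF P]]] by simp

text \<open>
  Unbounded search.  A property \<open>Q\<close> of \<open>x\<close> may be decided with the help of an auxiliary witness, as
  long as witnesses exist and all of them lead to the same answer.
\<close>

lemma decidable_on_witness:
  assumes W: "decidable_on (\<lambda>z. D (fst_code z)) (\<lambda>z. W (fst_code z) (snd_code z))"
    and ex: "\<And>x. D x \<Longrightarrow> \<exists>m. W x m"
    and P: "decidable_on (\<lambda>z. D (fst_code z) \<and> W (fst_code z) (snd_code z))
      (\<lambda>z. P (fst_code z) (snd_code z))"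
    and PQ: "\<And>x m. D x \<Longrightarrow> W x m \<Longrightarrow> P x m \<longleftrightarrow> Q x"
  shows "decidable_on D Q"
proof -
  from decidable_on_not [OF W] obtain F where F: "partial_recursive F"
    "\<And>z. D (fst_code z) \<Longrightarrow> F z = Some (of_bool (\<not> W (fst_code z) (snd_code z)))"
    unfolding decidable_on_def by blast
  from P obtain G where G: "partial_recursive G"
    "\<And>z. D (fst_code z) \<Longrightarrow> W (fst_code z) (snd_code z) \<Longrightarrow> G z = Some (of_bool (P (fst_code z) (snd_code z)))"
    unfolding decidable_on_def by blast
  let ?S = "\<lambda>a. if \<exists>m. F (prod_encode (a, m)) = Some 0 \<and> (\<forall>k<m. F (prod_encode (a, k)) \<noteq> None)
      then Some (LEAST m. F (prod_encode (a, m)) = Some 0) else None"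
  have id: "partial_recursive (\<lambda>e. Some e)"
    using recursive_id by (simp add: recursive_def)
  show ?thesis
    unfolding decidable_on_def
  proof (rule exI, intro conjI allI impI)
    show "partial_recursive (\<lambda>e. Option.bind (Some e) (\<lambda>u. Option.bind (?S e) (\<lambda>v. G (prod_encode (u, v)))))"
      by (rule partial_recursive_bind2 [OF G(1) id partial_recursive.mini [OF F(1)]])
  next
    fix x assume D: "D x"
    have Fx: "F (prod_encode (x, m)) = Some (of_bool (\<not> W x m))" for m
      using F(2) [of "prod_encode (x, m)"] D by simp
    let ?m = "LEAST m. W x m"
    have W: "W x ?m" using ex [OF D] by (rule LeastI_ex)
    have S: "?S x = Some ?m" using ex [OF D] by (simp add: Fx)
    show "Option.bind (Some x) (\<lambda>u. Option.bind (?S x) (\<lambda>v. G (prod_encode (u, v)))) = Some (of_bool (Q x))"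
      unfolding S using G(2) [of "prod_encode (x, ?m)"] D W PQ by simp
  qed
qed

end

section \<open>Homogeneous linear equations\<close>

text \<open>
  A homogeneous system which is underdetermined, or which has some nonzero real solution, has a
  nonzero solution in every subring containing its coefficients.  The unknown \<open>k\<close> is eliminated
  by multiplying across with a pivot \<open>d\<close> instead of dividing by it, and both alternatives of the
  hypothesis survive this step.  The first alternative, over \<open>\<real>\<close>, gives linear dependence of
  many vectors; the second one finds a stationary vector among polynomials.
\<close>

lemma homogeneous_solution_in_subring:
  fixes S :: "real set" and a :: "'e \<Rightarrow> 'i \<Rightarrow> real"
  assumes "finite I" "finite E"
    and S: "0 \<in> S" "1 \<in> S" "\<And>x y. x \<in> S \<Longrightarrow> y \<in> S \<Longrightarrow> x + y \<in> S"
      "\<And>x y. x \<in> S \<Longrightarrow> y \<in> S \<Longrightarrow> x * y \<in> S" "\<And>x. x \<in> S \<Longrightarrow> - x \<in> S"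
    and "\<And>e i. e \<in> E \<Longrightarrow> i \<in> I \<Longrightarrow> a e i \<in> S"
    and "card E < card I \<or> (\<exists>x. (\<exists>i\<in>I. x i \<noteq> 0) \<and> (\<forall>e\<in>E. (\<Sum>i\<in>I. a e i * x i) = 0))"
  shows "\<exists>x. (\<forall>i\<in>I. x i \<in> S) \<and> (\<exists>i\<in>I. x i \<noteq> 0) \<and> (\<forall>e\<in>E. (\<Sum>i\<in>I. a e i * x i) = 0)"
  using assms(1,2,8,9)
proof (induction I arbitrary: E a rule: finite_induct)
  case empty
  then show ?case by simp
next
  case (insert k I)
  show ?case
  proof (cases "\<forall>e\<in>E. a e k = 0")
    case True
    let ?x = "\<lambda>i. if i = k then 1 else 0"
    have "(\<Sum>i\<in>insert k I. a e i * ?x i) = 0" if "e \<in> E" for e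
      using insert.hyps True that by (intro sum.neutral) auto
    then show ?thesis
      using S(1,2) by (intro exI [of _ ?x]) auto
  next
    case False
    then obtain e0 where e0: "e0 \<in> E" "a e0 k \<noteq> 0" by auto
    \<comment> \<open>\<open>e0\<close> expresses the unknown \<open>k\<close> by the others and is consumed in doing so.\<close>
    let ?E = "E - {e0}"
    define d where "d = a e0 k"
    define a' where "a' = (\<lambda>e i. d * a e i - a e k * a e0 i)"
    have sum_a': "(\<Sum>i\<in>I. a' e i * x i) = d * (\<Sum>i\<in>I. a e i * x i) - a e k * (\<Sum>i\<in>I. a e0 i * x i)" for e x
      by (simp add: a'_def left_diff_distrib sum_subtractf sum_distrib_left mult.assoc)
    have split_sum: "(\<Sum>i\<in>insert k I. a e i * x i) = a e k * x k + (\<Sum>i\<in>I. a e i * x i)" for e x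
      using insert.hyps by simp
    have a'_S: "a' e i \<in> S" if "e \<in> ?E" "i \<in> I" for e i
    proof -
      have "d * a e i + - (a e k * a e0 i) \<in> S"
        using that e0 insert.prems(2) unfolding d_def by (intro S) auto
      then show ?thesis by (simp add: a'_def)
    qed
    have "card ?E < card I \<or> (\<exists>x. (\<exists>i\<in>I. x i \<noteq> 0) \<and> (\<forall>e\<in>?E. (\<Sum>i\<in>I. a' e i * x i) = 0))"
      using insert.prems(3)
    proof
      assume "card E < card (insert k I)"
      moreover have "card ?E = card E - 1" "card E > 0"
        using e0 insert.prems(1) by (auto simp: card_gt_0_iff)
      ultimately show ?thesis using insert.hyps by auto
    next
      assume "\<exists>x. (\<exists>i\<in>insert k I. x i \<noteq> 0) \<and> (\<forall>e\<in>E. (\<Sum>i\<in>insert k I. a e i * x i) = 0)"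
      then obtain x where x: "\<exists>i\<in>insert k I. x i \<noteq> 0" "\<And>e. e \<in> E \<Longrightarrow> (\<Sum>i\<in>insert k I. a e i * x i) = 0"
        by auto
      have sum_eq: "(\<Sum>i\<in>I. a e i * x i) = - (a e k * x k)" if "e \<in> E" for e
        using x(2) [OF that] unfolding split_sum by simp
      have "\<exists>i\<in>I. x i \<noteq> 0"
      proof (rule ccontr)
        assume none: "\<not> ?thesis"
        then have "a e0 k * x k = 0"
          using sum_eq [OF e0(1)] by simp
        then show False using x(1) e0(2) none by auto
      qed
      moreover have "(\<Sum>i\<in>I. a' e i * x i) = 0" if "e \<in> ?E" for e
        unfolding sum_a' using that by (simp add: sum_eq e0 d_def)
      ultimately show ?thesis by blast
    qed
    from insert.IH [OF _ a'_S this] insert.prems(1) obtain x where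
      x: "\<And>i. i \<in> I \<Longrightarrow> x i \<in> S" "\<exists>i\<in>I. x i \<noteq> 0" "\<And>e. e \<in> ?E \<Longrightarrow> (\<Sum>i\<in>I. a' e i * x i) = 0"
      by auto
    define t where "t = (\<Sum>i\<in>I. a e0 i * x i)"
    define y where "y = (\<lambda>i. if i = k then - t else d * x i)"
    have "(\<Sum>i\<in>J. a e0 i * x i) \<in> S" if "J \<subseteq> I" for J
      using finite_subset [OF that insert.hyps(1)] that
      by (induction J rule: finite_induct) (use x(1) insert.prems(2) e0 in \<open>auto intro!: S\<close>)
    then have "- t \<in> S" unfolding t_def by (intro S) auto
    then have "\<forall>i\<in>insert k I. y i \<in> S"
      using x(1) insert.prems(2) [of e0 k] e0 by (auto simp: y_def d_def intro!: S)
    moreover have "\<exists>i\<in>insert k I. y i \<noteq> 0"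
      using x(2) e0(2) insert.hyps by (auto simp: y_def d_def)
    moreover have "(\<Sum>i\<in>insert k I. a e i * y i) = 0" if "e \<in> E" for e
    proof -
      have "(\<Sum>i\<in>I. a e i * y i) = (\<Sum>i\<in>I. d * (a e i * x i))"
        using insert.hyps by (intro sum.cong) (auto simp: y_def)
      then have "(\<Sum>i\<in>insert k I. a e i * y i) = d * (\<Sum>i\<in>I. a e i * x i) - a e k * t"
        unfolding split_sum by (simp add: y_def sum_distrib_left)
      also have "\<dots> = 0"
      proof (cases "e = e0")
        case True
        then show ?thesis by (simp add: t_def d_def)
      next
        case False
        then show ?thesis using x(3) [of e] that unfolding sum_a' t_def by simp
      qed
      finally show ?thesis .
    qed
    ultimately show ?thesis by blast
  qed
qed

section \<open>Weighted automata and chains of annihilators\<close>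

definition pairing :: "'x set \<Rightarrow> ('x \<Rightarrow> real) \<Rightarrow> ('x \<Rightarrow> real) \<Rightarrow> real" where
  "pairing Q l h = (\<Sum>x\<in>Q. l x * h x)"

definition annihilator :: "'x set \<Rightarrow> ('x \<Rightarrow> real) set \<Rightarrow> ('x \<Rightarrow> real) set" where
  "annihilator Q H = {l. \<forall>h\<in>H. pairing Q l h = 0}"

text \<open>
  Subspaces are represented as annihilators.  If all inclusions were strict, each step would provide
  a vector \<open>v\<^sub>j\<close> outside the previous subspace; these are \<open>card Q + 1\<close> vectors, and the last one
  occurring in a linear relation between them would belong to a subspace which it avoids.
\<close>

lemma annihilator_chain_stationary:
  assumes Q: "finite Q"
    and inc: "\<And>j. j \<le> card Q \<Longrightarrow> annihilator Q (H j) \<subseteq> annihilator Q (H (Suc j))"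
  shows "\<exists>j\<le>card Q. annihilator Q (H j) = annihilator Q (H (Suc j))"
proof (rule ccontr)
  assume "\<not> ?thesis"
  then have "\<forall>j. \<exists>l. j \<le> card Q \<longrightarrow> l \<in> annihilator Q (H (Suc j)) - annihilator Q (H j)"
    using inc by blast
  then obtain v where v: "\<And>j. j \<le> card Q \<Longrightarrow> v j \<in> annihilator Q (H (Suc j)) - annihilator Q (H j)"
    by metis
  have mono: "annihilator Q (H i) \<subseteq> annihilator Q (H j)" if "i \<le> j" "j \<le> Suc (card Q)" for i j
    using that
  proof (induction j rule: dec_induct)
    case (step j)
    then show ?case using inc [of j] by auto
  qed simp
  let ?I = "{..card Q}"
  have "\<exists>c. (\<forall>i\<in>?I. c i \<in> UNIV) \<and> (\<exists>i\<in>?I. c i \<noteq> 0) \<and> (\<forall>x\<in>Q. (\<Sum>i\<in>?I. v i x * c i) = 0)"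
    by (rule homogeneous_solution_in_subring) (auto simp: Q)
  then obtain c where c: "\<exists>i\<in>?I. c i \<noteq> 0" "\<And>x. x \<in> Q \<Longrightarrow> (\<Sum>i\<in>?I. v i x * c i) = 0"
    by auto
  define m where "m = Max {i \<in> ?I. c i \<noteq> 0}"
  have fin: "finite {i \<in> ?I. c i \<noteq> 0}" by simp
  have "m \<in> {i \<in> ?I. c i \<noteq> 0}"
    unfolding m_def using Max_in [OF fin] c(1) by blast
  then have m: "m \<le> card Q" "c m \<noteq> 0" by auto
  have above: "c i = 0" if "i \<in> ?I" "m < i" for i
    using Max_ge [OF fin, of i] that unfolding m_def by (metis (mono_tags, lifting) mem_Collect_eq not_le)
  have "pairing Q (v m) h = 0" if h: "h \<in> H m" for h
  proof -
    have "(\<Sum>i\<in>?I. c i * pairing Q (v i) h) = (\<Sum>x\<in>Q. (\<Sum>i\<in>?I. v i x * c i) * h x)"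
      unfolding pairing_def sum_distrib_left sum_distrib_right
      by (subst sum.swap) (simp add: mult_ac)
    also have "\<dots> = 0" by (intro sum.neutral) (simp add: c(2))
    finally have zero: "(\<Sum>i\<in>?I. c i * pairing Q (v i) h) = 0" .
    have "c i * pairing Q (v i) h = 0" if "i \<in> ?I - {m}" for i
    proof (cases "m < i")
      case True
      then show ?thesis using above that by simp
    next
      case False
      then have "v i \<in> annihilator Q (H m)"
        using v [of i] mono [of "Suc i" m] m that by auto
      then show ?thesis using h by (simp add: annihilator_def)
    qed
    then have "(\<Sum>i\<in>?I - {m}. c i * pairing Q (v i) h) = 0"
      by (intro sum.neutral) blast
    then have "(\<Sum>i\<in>?I. c i * pairing Q (v i) h) = c m * pairing Q (v m) h"
      using m sum.remove [of ?I m "\<lambda>i. c i * pairing Q (v i) h"] by simp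
    with zero m show ?thesis by simp
  qed
  then show False using v [OF m(1)] by (auto simp: annihilator_def)
qed

locale weighted_automaton =
  fixes Q :: "'x set" and M :: "'b \<Rightarrow> 'x \<Rightarrow> 'x \<Rightarrow> real"
  assumes finite_states: "finite Q"
begin

definition forward :: "('x \<Rightarrow> real) \<Rightarrow> 'b \<Rightarrow> 'x \<Rightarrow> real" where
  "forward l b = (\<lambda>y. \<Sum>x\<in>Q. l x * M b x y)"

definition backward :: "'b \<Rightarrow> ('x \<Rightarrow> real) \<Rightarrow> 'x \<Rightarrow> real" where
  "backward b h = (\<lambda>x. \<Sum>y\<in>Q. M b x y * h y)"

lemma pairing_forward: "pairing Q (forward l b) h = pairing Q l (backward b h)"
  unfolding pairing_def forward_def backward_def sum_distrib_left sum_distrib_right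
  by (subst sum.swap) (simp add: mult_ac)

abbreviation after :: "('x \<Rightarrow> real) \<Rightarrow> 'b list \<Rightarrow> 'x \<Rightarrow> real" where
  "after \<equiv> foldl forward"

abbreviation before :: "'b list \<Rightarrow> ('x \<Rightarrow> real) \<Rightarrow> 'x \<Rightarrow> real" where
  "before \<equiv> foldr backward"

lemma pairing_after: "pairing Q (after l w) h = pairing Q l (before w h)"
  by (induction w arbitrary: l) (simp_all add: pairing_forward)

text \<open>
  The vectors killed by all words of length at most \<open>j\<close> form a decreasing chain in which
  each member is determined by the previous one, so the chain is constant from \<open>j = card Q\<close> on.
\<close>

lemma vanishes_if_vanishes_on_short_words:
  assumes short: "\<And>w. w \<in> lists \<Sigma> \<Longrightarrow> length w \<le> card Q \<Longrightarrow> pairing Q l (before w h) = 0"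
    and w: "w \<in> lists \<Sigma>"
  shows "pairing Q l (before w h) = 0"
proof -
  define H where "H j = {before w h |w. w \<in> lists \<Sigma> \<and> length w \<le> j}" for j
  have anti: "annihilator Q (H j) \<subseteq> annihilator Q (H i)" if "i \<le> j" for i j
    using that unfolding annihilator_def H_def by fastforce
  \<comment> \<open>The chain decreases; it is traversed backwards, starting with \<open>H (card Q + 1)\<close>.\<close>
  have "\<exists>i\<le>card Q. annihilator Q (H (Suc (card Q) - i)) = annihilator Q (H (Suc (card Q) - Suc i))"
    by (rule annihilator_chain_stationary [OF finite_states]) (auto intro!: anti)
  then obtain i where i: "i \<le> card Q"
    "annihilator Q (H (Suc (card Q) - i)) = annihilator Q (H (Suc (card Q) - Suc i))" by blast
  define j where "j = card Q - i"
  have j: "j \<le> card Q" "annihilator Q (H (Suc j)) = annihilator Q (H j)"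
    using i(2) Suc_diff_le [OF i(1)] by (simp_all add: j_def)
  have peel: "l \<in> annihilator Q (H (Suc i)) \<longleftrightarrow>
      pairing Q l h = 0 \<and> (\<forall>b\<in>\<Sigma>. forward l b \<in> annihilator Q (H i))" for i l
  proof
    assume l: "l \<in> annihilator Q (H (Suc i))"
    have "before [] h \<in> H (Suc i)" unfolding H_def by (intro CollectI exI [of _ "[]"]) simp
    moreover have "before (b # w) h \<in> H (Suc i)" if "b \<in> \<Sigma>" "w \<in> lists \<Sigma>" "length w \<le> i" for b w
      using that unfolding H_def by (intro CollectI exI [of _ "b # w"]) auto
    ultimately show "pairing Q l h = 0 \<and> (\<forall>b\<in>\<Sigma>. forward l b \<in> annihilator Q (H i))"
      using l by (auto simp: annihilator_def H_def [of i] pairing_forward)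
  next
    assume r: "pairing Q l h = 0 \<and> (\<forall>b\<in>\<Sigma>. forward l b \<in> annihilator Q (H i))"
    have "pairing Q l (before w h) = 0" if "w \<in> lists \<Sigma>" "length w \<le> Suc i" for w
    proof (cases w)
      case (Cons b w')
      then have "before w' h \<in> H i" using that by (auto simp: H_def)
      then show ?thesis
        using r that Cons by (auto simp: annihilator_def pairing_forward)
    qed (use r in simp)
    then show "l \<in> annihilator Q (H (Suc i))" by (auto simp: annihilator_def H_def)
  qed
  have stable: "annihilator Q (H (Suc i)) = annihilator Q (H i)" if "j \<le> i" for i
    using that
  proof (induction i rule: dec_induct)
    case (step i)
    show ?case using peel [of _ "Suc i"] peel [of _ i] step.IH by blast
  qed (rule j)
  have *: "annihilator Q (H i) = annihilator Q (H j)" if "j \<le> i" for i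
    using that by (induction i rule: dec_induct) (auto simp: stable)
  have "l \<in> annihilator Q (H j)"
    using short j(1) by (fastforce simp: annihilator_def H_def)
  then have "l \<in> annihilator Q (H (max j (length w)))"
    using * [of "max j (length w)"] by simp
  moreover have "before w h \<in> H (max j (length w))" using w by (auto simp: H_def)
  ultimately show ?thesis by (simp add: annihilator_def)
qed

text \<open>
  Let \<open>G\<close> be a set of tests which is closed under prefixing letters.  Then passing all tests after
  reading any \<open>j\<close> letters is a condition which weakens with \<open>j\<close>, and again the resulting chain of
  subspaces is determined step by step.  Whatever holds for words of some length \<open>k\<close>, however large,
  therefore holds for words of length \<open>card Q\<close>.
\<close>

lemma annihilated_by_long_words:
  assumes closed: "\<And>b h. h \<in> G \<Longrightarrow> backward b h \<in> G"
    and k: "\<And>u h. length u = k \<Longrightarrow> h \<in> G \<Longrightarrow> pairing Q l (before u h) = 0"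
    and u: "length u = card Q" and h: "h \<in> G"
  shows "pairing Q l (before u h) = 0"
proof -
  define H where "H j = {before u h |u h. length u = j \<and> h \<in> G}" for j
  have H_0: "H 0 = G" by (auto simp: H_def)
  have peel: "l \<in> annihilator Q (H (Suc i)) \<longleftrightarrow> (\<forall>b. forward l b \<in> annihilator Q (H i))" for i l
  proof
    assume l: "l \<in> annihilator Q (H (Suc i))"
    have "before (b # u) h \<in> H (Suc i)" if "length u = i" "h \<in> G" for b u h
      using that unfolding H_def by fastforce
    then show "\<forall>b. forward l b \<in> annihilator Q (H i)"
      using l by (auto simp: annihilator_def H_def [of i] pairing_forward)
  next
    assume r: "\<forall>b. forward l b \<in> annihilator Q (H i)"
    have "pairing Q l (before u h) = 0" if "length u = Suc i" "h \<in> G" for u h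
    proof -
      from that obtain b u' where u: "u = b # u'" "length u' = i" by (cases u) auto
      then have "before u' h \<in> H i" using that by (auto simp: H_def)
      then show ?thesis using r u by (auto simp: annihilator_def pairing_forward)
    qed
    then show "l \<in> annihilator Q (H (Suc i))" by (auto simp: annihilator_def H_def)
  qed
  have inc: "annihilator Q (H i) \<subseteq> annihilator Q (H (Suc i))" for i
  proof (induction i)
    case 0
    show ?case using closed by (auto simp: peel) (auto simp: H_0 annihilator_def pairing_forward)
  next
    case (Suc i)
    then show ?case using peel [of _ "Suc i"] peel [of _ i] by blast
  qed
  have mono: "annihilator Q (H i) \<subseteq> annihilator Q (H j)" if "i \<le> j" for i j
    using lift_Suc_mono_le [of "\<lambda>i. annihilator Q (H i)", OF inc that] .
  obtain j where j: "j \<le> card Q" "annihilator Q (H (Suc j)) = annihilator Q (H j)"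
    using annihilator_chain_stationary [OF finite_states, of H] inc by auto
  have stable: "annihilator Q (H (Suc i)) = annihilator Q (H i)" if "j \<le> i" for i
    using that
  proof (induction i rule: dec_induct)
    case (step i)
    show ?case using peel [of _ "Suc i"] peel [of _ i] step.IH by blast
  qed (rule j)
  have *: "annihilator Q (H i) = annihilator Q (H j)" if "j \<le> i" for i
    using that by (induction i rule: dec_induct) (auto simp: stable)
  have "l \<in> annihilator Q (H k)" using k by (auto simp: annihilator_def H_def)
  then have "l \<in> annihilator Q (H (max j k))" using mono [of k "max j k"] by auto
  then have "l \<in> annihilator Q (H (card Q))" using * [of "max j k"] * [of "card Q"] j by simp
  then show ?thesis using u h by (auto simp: annihilator_def H_def)
qed

end

section \<open>The order of a hidden Markov chain\<close>

text \<open>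
  Where \<open>\<nu> u\<close> does not vanish, this says that past and future of an occurrence of \<open>u\<close> are independent.
\<close>

definition splits_at :: "('b list \<Rightarrow> real) \<Rightarrow> 'b list \<Rightarrow> bool" where
  "splits_at \<nu> u \<longleftrightarrow> (\<forall>w v. \<nu> (w @ u @ v) * \<nu> u = \<nu> (w @ u) * \<nu> (u @ v))"

text \<open>
  Of the fact that \<open>\<nu>\<close> comes from a probability measure, linear algebra only uses that a null word has
  no extensions of nonzero weight.
\<close>

locale positive_automaton = weighted_automaton Q M
  for Q :: "'x set" and M :: "'b \<Rightarrow> 'x \<Rightarrow> 'x \<Rightarrow> real" +
  fixes \<pi> \<eta> :: "'x \<Rightarrow> real"
  assumes null_extension: "\<And>w u v. pairing Q \<pi> (before u \<eta>) = 0 \<Longrightarrow> pairing Q \<pi> (before (w @ u @ v) \<eta>) = 0"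
begin

definition \<nu> :: "'b list \<Rightarrow> real" where
  "\<nu> w = pairing Q \<pi> (before w \<eta>)"

lemma null: "\<nu> u = 0 \<Longrightarrow> \<nu> (w @ u @ v) = 0"
  using null_extension by (simp add: \<nu>_def)

text \<open>
  Unlike the definition, the condition on minors is bilinear in the pair of left contexts and in the
  pair of right contexts; this is what makes it accessible to linear algebra.
\<close>

lemma splits_at_iff_minors:
  "splits_at \<nu> u \<longleftrightarrow> (\<forall>w w' v v'. \<nu> (w @ u @ v) * \<nu> (w' @ u @ v') = \<nu> (w @ u @ v') * \<nu> (w' @ u @ v))"
proof
  assume s: "splits_at \<nu> u"
  show "\<forall>w w' v v'. \<nu> (w @ u @ v) * \<nu> (w' @ u @ v') = \<nu> (w @ u @ v') * \<nu> (w' @ u @ v)"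
  proof (cases "\<nu> u = 0")
    case True
    then show ?thesis by (simp add: null)
  next
    case False
    show ?thesis
    proof (intro allI)
      fix w w' v v'
      have *: "\<nu> (w @ u @ v) = \<nu> (w @ u) * \<nu> (u @ v) / \<nu> u" for w v
        using s False by (simp add: splits_at_def field_simps)
      show "\<nu> (w @ u @ v) * \<nu> (w' @ u @ v') = \<nu> (w @ u @ v') * \<nu> (w' @ u @ v)"
        by (simp add: * [of _ v] * [of _ v'])
    qed
  qed
next
  assume "\<forall>w w' v v'. \<nu> (w @ u @ v) * \<nu> (w' @ u @ v') = \<nu> (w @ u @ v') * \<nu> (w' @ u @ v)"
  then have "\<nu> (w @ u @ v) * \<nu> ([] @ u @ []) = \<nu> (w @ u @ []) * \<nu> ([] @ u @ v)" for w v
    by blast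
  then show "splits_at \<nu> u" by (simp add: splits_at_def)
qed

lemma splits_at_extend: "splits_at \<nu> u \<Longrightarrow> splits_at \<nu> (w @ u @ v)"
  unfolding splits_at_iff_minors by (metis append.assoc)

text \<open>
  The minors are the values of an automaton with pairs of states, started in a tensor product
  and tested against the antisymmetric functionals \<open>minor v v'\<close>.  Prefixing a letter to both \<open>v\<close> and
  \<open>v'\<close> yields a functional of the same kind, so the chain argument applies in dimension \<open>(card Q)\<^sup>2\<close>.
\<close>

theorem splits_at_long_words:
  assumes k: "\<And>u. length u = k \<Longrightarrow> splits_at \<nu> u" and u: "card Q * card Q \<le> length u"
  shows "splits_at \<nu> u"
proof -
  interpret pairs: weighted_automaton "Q \<times> Q" "\<lambda>b p q. M b (fst p) (fst q) * M b (snd p) (snd q)"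
    by unfold_locales (simp add: finite_states)
  define tensor :: "('x \<Rightarrow> real) \<Rightarrow> ('x \<Rightarrow> real) \<Rightarrow> 'x \<times> 'x \<Rightarrow> real"
    where "tensor f g = (\<lambda>p. f (fst p) * g (snd p))" for f g
  define minor where "minor v v' = (\<lambda>p. tensor (before v \<eta>) (before v' \<eta>) p - tensor (before v' \<eta>) (before v \<eta>) p)" for v v'
  have backward_minor: "pairs.backward b (minor v v') = minor (b # v) (b # v')" for b v v'
    unfolding pairs.backward_def minor_def tensor_def backward_def
    by (simp add: fun_eq_iff sum_product sum.cartesian_product case_prod_beta right_diff_distrib sum_subtractf mult_ac)
  have before_minor: "pairs.before u (minor v v') = minor (u @ v) (u @ v')" for u v v'
    by (induction u) (simp_all add: backward_minor)
  have pairing_tensor: "pairing (Q \<times> Q) (tensor l l') (minor v v') =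
      pairing Q l (before v \<eta>) * pairing Q l' (before v' \<eta>) - pairing Q l (before v' \<eta>) * pairing Q l' (before v \<eta>)" for l l' v v'
  proof -
    have product: "pairing Q l h * pairing Q l' h' = (\<Sum>p\<in>Q \<times> Q. l (fst p) * h (fst p) * (l' (snd p) * h' (snd p)))" for h h'
      unfolding pairing_def sum_product sum.cartesian_product by (simp add: case_prod_beta)
    show ?thesis
      unfolding product unfolding pairing_def minor_def tensor_def
      by (simp add: right_diff_distrib sum_subtractf mult_ac)
  qed
  have \<nu>_split: "\<nu> (w @ v) = pairing Q (after \<pi> w) (before v \<eta>)" for w v
    by (simp add: \<nu>_def pairing_after)
  have minors: "pairing (Q \<times> Q) (tensor (after \<pi> w) (after \<pi> w')) (pairs.before u (minor v v')) =
      \<nu> (w @ u @ v) * \<nu> (w' @ u @ v') - \<nu> (w @ u @ v') * \<nu> (w' @ u @ v)" for w w' u v v'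
    unfolding before_minor pairing_tensor by (simp only: \<nu>_split)
  have "splits_at \<nu> u" if u: "length u = card Q * card Q" for u
    unfolding splits_at_iff_minors
  proof (intro allI)
    fix w w' v v'
    have "pairing (Q \<times> Q) (tensor (after \<pi> w) (after \<pi> w')) (pairs.before u (minor v v')) = 0"
    proof (rule pairs.annihilated_by_long_words [where G = "{minor v v' |v v'. True}" and k = k])
      show "pairs.backward b h \<in> {minor v v' |v v'. True}" if "h \<in> {minor v v' |v v'. True}" for b h
        using that backward_minor by blast
      show "pairing (Q \<times> Q) (tensor (after \<pi> w) (after \<pi> w')) (pairs.before u h) = 0"
        if "length u = k" "h \<in> {minor v v' |v v'. True}" for u h
        using k [OF that(1)] that(2) minors unfolding splits_at_iff_minors by auto
    qed (use u in \<open>auto simp: card_cartesian_product\<close>)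
    then show "\<nu> (w @ u @ v) * \<nu> (w' @ u @ v') = \<nu> (w @ u @ v') * \<nu> (w' @ u @ v)"
      unfolding minors by simp
  qed
  then have "splits_at \<nu> (take (card Q * card Q) u)" using u by simp
  from splits_at_extend [OF this, of "[]" "drop (card Q * card Q) u"] show ?thesis by simp
qed

text \<open>
  For fixed \<open>w\<close> the equation is linear in the vector of the right context \<open>v\<close>, and for fixed \<open>v\<close> it is
  linear in the vector of the left context \<open>w\<close>; short contexts are enough in either case.
  Letters outside \<open>\<Sigma>\<close> make both sides vanish.
\<close>

theorem splits_at_if_splits_short_contexts:
  assumes \<Sigma>: "\<And>b w v. b \<notin> \<Sigma> \<Longrightarrow> \<nu> (w @ b # v) = 0"
    and u: "u \<in> lists \<Sigma>"
    and short: "\<And>w v. w \<in> lists \<Sigma> \<Longrightarrow> v \<in> lists \<Sigma> \<Longrightarrow> length w \<le> card Q \<Longrightarrow> length v \<le> card Q \<Longrightarrow>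
      \<nu> (w @ u @ v) * \<nu> u = \<nu> (w @ u) * \<nu> (u @ v)"
  shows "splits_at \<nu> u"
proof -
  have \<nu>_split: "\<nu> (w @ v) = pairing Q (after \<pi> w) (before v \<eta>)" for w v
    by (simp add: \<nu>_def pairing_after)
  have pairing_diff: "pairing Q (\<lambda>x. c * l x - c' * l' x) h = c * pairing Q l h - c' * pairing Q l' h" for c l c' l' h
    unfolding pairing_def by (simp add: left_diff_distrib sum_subtractf sum_distrib_left mult.assoc)
  have pairing_diff': "pairing Q l (\<lambda>x. c * h x - c' * h' x) = c * pairing Q l h - c' * pairing Q l h'" for c l c' h h'
    unfolding pairing_def by (simp add: right_diff_distrib sum_subtractf sum_distrib_left mult_ac)
  have *: "\<nu> (w @ u @ v) * \<nu> u = \<nu> (w @ u) * \<nu> (u @ v)"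
    if w: "w \<in> lists \<Sigma>" "length w \<le> card Q" and v: "v \<in> lists \<Sigma>" for w v
  proof -
    let ?l = "\<lambda>x. \<nu> u * after \<pi> (w @ u) x - \<nu> (w @ u) * after \<pi> u x"
    have eq: "pairing Q ?l (before v \<eta>) = \<nu> u * \<nu> (w @ u @ v) - \<nu> (w @ u) * \<nu> (u @ v)" for v
      unfolding pairing_diff \<nu>_split [of "w @ u" v, symmetric] \<nu>_split [of "u" v, symmetric] by simp
    have "pairing Q ?l (before v \<eta>) = 0"
    proof (rule vanishes_if_vanishes_on_short_words [OF _ v])
      fix v assume "v \<in> lists \<Sigma>" "length v \<le> card Q"
      from short [OF w(1) this(1) w(2) this(2)] show "pairing Q ?l (before v \<eta>) = 0"
        unfolding eq by (simp add: mult.commute)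
    qed
    then show ?thesis unfolding eq by (simp add: mult.commute)
  qed
  have **: "\<nu> (w @ u @ v) * \<nu> u = \<nu> (w @ u) * \<nu> (u @ v)" if w: "w \<in> lists \<Sigma>" and v: "v \<in> lists \<Sigma>" for w v
  proof -
    let ?h = "\<lambda>x. \<nu> u * before (u @ v) \<eta> x - \<nu> (u @ v) * before u \<eta> x"
    have eq: "pairing Q \<pi> (before w ?h) = \<nu> u * \<nu> (w @ u @ v) - \<nu> (u @ v) * \<nu> (w @ u)" for w
      by (simp only: pairing_after [of \<pi> w, symmetric] pairing_diff' \<nu>_split)
    have "pairing Q \<pi> (before w ?h) = 0"
    proof (rule vanishes_if_vanishes_on_short_words [OF _ w])
      fix w assume "w \<in> lists \<Sigma>" "length w \<le> card Q"
      from * [OF this v] show "pairing Q \<pi> (before w ?h) = 0"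
        unfolding eq by (simp add: mult.commute)
    qed
    then show ?thesis unfolding eq by (simp add: mult.commute)
  qed
  show ?thesis
    unfolding splits_at_def
  proof (intro allI)
    fix w v
    have bad: "\<nu> x = 0" if "x \<notin> lists \<Sigma>" for x
      using that \<Sigma> by (metis in_listsI split_list)
    show "\<nu> (w @ u @ v) * \<nu> u = \<nu> (w @ u) * \<nu> (u @ v)"
    proof (cases "w \<in> lists \<Sigma> \<and> v \<in> lists \<Sigma>")
      case True
      then show ?thesis using ** by blast
    next
      case False
      then have "\<nu> (w @ u @ v) = 0" "\<nu> (w @ u) = 0 \<or> \<nu> (u @ v) = 0"
        by (auto intro!: bad)
      then show ?thesis by auto
    qed
  qed
qed

end

section \<open>The stationary vector up to a factor\<close>

text \<open>
  Irreducibility in the form in which it is used: no proper nonempty set of states is closed under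
  positive transitions.
\<close>

definition connected_weights :: "nat \<Rightarrow> (nat \<Rightarrow> nat \<Rightarrow> real) \<Rightarrow> bool" where
  "connected_weights n P \<longleftrightarrow>
     (\<forall>i<n. \<forall>j<n. 0 \<le> P i j) \<and>
     (\<forall>S. S \<subseteq> {..<n} \<and> S \<noteq> {} \<and> (\<forall>i\<in>S. \<forall>j<n. 0 < P i j \<longrightarrow> j \<in> S) \<longrightarrow> S = {..<n})"

lemma nonneg_fixed_vector_zero_or_positive:
  assumes P: "connected_weights n P"
    and nonneg: "\<And>i. i < n \<Longrightarrow> 0 \<le> r i"
    and fixed: "\<And>j. j < n \<Longrightarrow> (\<Sum>i<n. r i * P i j) = r j"
    and i: "i < n" "r i > 0" and j: "j < n"
  shows "r j > 0"
proof -
  have "{i. i < n \<and> r i > 0} = {..<n}"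
  proof -
    have closed: "r l > 0" if "k < n" "r k > 0" "l < n" "0 < P k l" for k l
    proof -
      have "0 < r k * P k l" using that by simp
      also have "\<dots> \<le> (\<Sum>i<n. r i * P i l)"
        using that P nonneg
        by (intro member_le_sum [where f = "\<lambda>i. r i * P i l"]) (auto simp: connected_weights_def)
      finally show ?thesis using fixed that by simp
    qed
    have all: "T = {..<n}" if "T \<subseteq> {..<n}" "T \<noteq> {}" "\<forall>k\<in>T. \<forall>l<n. 0 < P k l \<longrightarrow> l \<in> T" for T
      using P that unfolding connected_weights_def by simp
    show ?thesis
      by (rule all) (use i closed in auto)
  qed
  then show ?thesis using j by blast
qed

text \<open>
  Subtract from \<open>q\<close> the largest multiple of the positive vector \<open>p\<close> that leaves it nonnegative.  The
  remainder is fixed, nonnegative and has a zero component, so it is zero.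
\<close>

lemma fixed_vector_unique:
  assumes P: "connected_weights n P"
    and p: "\<And>i. i < n \<Longrightarrow> 0 \<le> p i" "(\<Sum>i<n. p i) = 1" "\<And>j. j < n \<Longrightarrow> (\<Sum>i<n. p i * P i j) = p j"
    and q: "\<And>j. j < n \<Longrightarrow> (\<Sum>i<n. q i * P i j) = q j"
  shows "\<exists>c. \<forall>i<n. q i = c * p i"
proof -
  obtain k where k: "k < n" "p k > 0"
  proof (rule ccontr)
    assume "\<not> thesis"
    then have "(\<Sum>i<n. p i) \<le> 0"
      using that by (intro sum_nonpos) (meson lessThan_iff not_le)
    then show False using p(2) by simp
  qed
  have pos: "p j > 0" if "j < n" for j
    using nonneg_fixed_vector_zero_or_positive [OF P p(1,3) k that] .
  define c where "c = Min ((\<lambda>i. q i / p i) ` {..<n})"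
  have fin: "finite ((\<lambda>i. q i / p i) ` {..<n})" by simp
  have c_le: "c * p i \<le> q i" if "i < n" for i
  proof -
    have "c \<le> q i / p i" unfolding c_def using that by (intro Min_le) auto
    then show ?thesis using pos [OF that] by (simp add: field_simps)
  qed
  have "c \<in> (\<lambda>i. q i / p i) ` {..<n}"
    unfolding c_def using k by (intro Min_in fin) auto
  then obtain m where m: "m < n" "c = q m / p m" by auto
  define r where "r i = q i - c * p i" for i
  have "r m = 0" using m pos [of m] by (simp add: r_def)
  have r: "\<And>i. i < n \<Longrightarrow> 0 \<le> r i" "\<And>j. j < n \<Longrightarrow> (\<Sum>i<n. r i * P i j) = r j"
    using c_le q p(3)
    by (auto simp: r_def left_diff_distrib sum_subtractf mult.assoc simp flip: sum_distrib_left)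
  have "r i = 0" if "i < n" for i
  proof (rule ccontr)
    assume "r i \<noteq> 0"
    then have "r i > 0" using r(1) [OF that] by simp
    from nonneg_fixed_vector_zero_or_positive [OF P r that this m(1)] \<open>r m = 0\<close>
    show False by simp
  qed
  then show ?thesis by (auto simp: r_def)
qed

lemma fixed_vector_in_subring:
  fixes n :: nat
  assumes S: "0 \<in> S" "1 \<in> S" "\<And>x y. x \<in> S \<Longrightarrow> y \<in> S \<Longrightarrow> x + y \<in> S"
      "\<And>x y. x \<in> S \<Longrightarrow> y \<in> S \<Longrightarrow> x * y \<in> S" "\<And>x. x \<in> S \<Longrightarrow> - x \<in> S"
    and P: "\<And>i j. i < n \<Longrightarrow> j < n \<Longrightarrow> P i j \<in> S"
    and p: "(\<Sum>i<n. p i) = (1 :: real)" "\<And>j. j < n \<Longrightarrow> (\<Sum>i<n. p i * P i j) = p j"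
  shows "\<exists>q. (\<forall>i<n. q i \<in> S) \<and> (\<exists>i<n. q i \<noteq> 0) \<and> (\<forall>j<n. (\<Sum>i<n. q i * P i j) = q j)"
proof -
  define a where "a j i = P i j + (if i = j then - 1 else 0)" for j i
  have sum_a: "(\<Sum>i<n. a j i * x i) = (\<Sum>i<n. x i * P i j) - x j" if "j < n" for x j
  proof -
    have "(\<Sum>i<n. a j i * x i) = (\<Sum>i<n. x i * P i j + (if i = j then - x j else 0))"
      by (intro sum.cong) (auto simp: a_def algebra_simps)
    also have "\<dots> = (\<Sum>i<n. x i * P i j) - x j"
      using that by (simp add: sum.distrib)
    finally show ?thesis .
  qed
  have "\<exists>q. (\<forall>i\<in>{..<n}. q i \<in> S) \<and> (\<exists>i\<in>{..<n}. q i \<noteq> 0) \<and>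
      (\<forall>j\<in>{..<n}. (\<Sum>i\<in>{..<n}. a j i * q i) = 0)"
  proof (rule homogeneous_solution_in_subring [OF _ _ S])
    show "a j i \<in> S" if "j \<in> {..<n}" "i \<in> {..<n}" for j i
      unfolding a_def using that by (intro S(3)) (auto intro: S P)
    have "\<exists>i\<in>{..<n}. p i \<noteq> 0"
    proof (rule ccontr)
      assume "\<not> ?thesis"
      then have "(\<Sum>i<n. p i) = 0" by (intro sum.neutral) auto
      then show False using p(1) by simp
    qed
    then show "card {..<n} < card {..<n} \<or>
        (\<exists>x. (\<exists>i\<in>{..<n}. x i \<noteq> 0) \<and> (\<forall>e\<in>{..<n}. (\<Sum>i<n. a e i * x i) = 0))"
      using p(2) by (intro disjI2 exI [of _ p]) (auto simp: sum_a)
  qed auto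
  then show ?thesis by (auto simp: sum_a)
qed

text \<open>
  The integer polynomials in the values \<open>f a\<close>, written as lists of signed monomials; the parity of the
  first component of a monomial is its sign.  They form the smallest subring containing these values,
  and this representation makes the ring operations plain list operations.
\<close>

definition signed_sum :: "('a \<Rightarrow> real) \<Rightarrow> (nat \<times> 'a list) list \<Rightarrow> real" where
  "signed_sum f ms = (\<Sum>(\<sigma>, m)\<leftarrow>ms. (- 1) ^ \<sigma> * prod_list (map f m))"

lemma signed_sum_append: "signed_sum f (ms @ ms') = signed_sum f ms + signed_sum f ms'"
  by (simp add: signed_sum_def)

lemma signed_sum_uminus: "signed_sum f (map (map_prod Suc id) ms) = - signed_sum f ms"
  by (induction ms) (auto simp: signed_sum_def)

lemma signed_sum_mult:
  "signed_sum f ms * signed_sum f ms' =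
    signed_sum f (concat (map (\<lambda>(\<sigma>, m). map (\<lambda>(\<sigma>', m'). (\<sigma> + \<sigma>', m @ m')) ms') ms))"
proof (induction ms)
  case (Cons x ms)
  obtain \<sigma> m where x: "x = (\<sigma>, m)" by force
  have "signed_sum f (map (\<lambda>(\<sigma>', m'). (\<sigma> + \<sigma>', m @ m')) ms') = (- 1) ^ \<sigma> * prod_list (map f m) * signed_sum f ms'"
    by (induction ms') (auto simp: signed_sum_def power_add algebra_simps)
  with Cons x show ?case
    by (simp add: signed_sum_append distrib_right) (simp add: signed_sum_def distrib_right)
qed (simp add: signed_sum_def)

text \<open>
  The subring to which elimination is applied consists of the polynomials in the \<open>P i j\<close> with
  \<open>i, j < n\<close>; the real solution required is \<open>p\<close>.
\<close>

lemma fixed_vector_signed_sum: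
  fixes n :: nat
  assumes p: "(\<Sum>i<n. p i) = (1 :: real)" "\<And>j. j < n \<Longrightarrow> (\<Sum>i<n. p i * P i j) = p j"
  shows "\<exists>ms. (\<forall>i. \<forall>x\<in>set (ms i). set (snd x) \<subseteq> {..<n} \<times> {..<n}) \<and>
    (\<exists>i<n. signed_sum (case_prod P) (ms i) \<noteq> 0) \<and>
    (\<forall>j<n. (\<Sum>i<n. signed_sum (case_prod P) (ms i) * P i j) = signed_sum (case_prod P) (ms j))"
proof -
  define T :: "(nat \<times> (nat \<times> nat) list) list set"
    where "T = {ms. \<forall>x\<in>set ms. set (snd x) \<subseteq> {..<n} \<times> {..<n}}"
  define S where "S = signed_sum (case_prod P) ` T"
  have "\<exists>q. (\<forall>i<n. q i \<in> S) \<and> (\<exists>i<n. q i \<noteq> 0) \<and> (\<forall>j<n. (\<Sum>i<n. q i * P i j) = q j)"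
  proof (rule fixed_vector_in_subring [OF _ _ _ _ _ _ p])
    show "0 \<in> S"
      unfolding S_def by (rule image_eqI [of _ _ "[]"]) (auto simp: signed_sum_def T_def)
    show "1 \<in> S"
      unfolding S_def by (rule image_eqI [of _ _ "[(0, [])]"]) (auto simp: signed_sum_def T_def)
    show "P i j \<in> S" if "i < n" "j < n" for i j
      unfolding S_def using that
      by (intro image_eqI [of _ _ "[(0, [(i, j)])]"]) (auto simp: signed_sum_def T_def)
    fix x y assume "x \<in> S"
    then obtain mx where mx: "mx \<in> T" "x = signed_sum (case_prod P) mx" by (auto simp: S_def)
    show "- x \<in> S"
      using mx unfolding S_def
      by (intro image_eqI [of _ _ "map (map_prod Suc id) mx"])
        (simp add: signed_sum_uminus, fastforce simp: T_def)
    assume "y \<in> S"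
    then obtain my where my: "my \<in> T" "y = signed_sum (case_prod P) my" by (auto simp: S_def)
    show "x + y \<in> S"
      using mx my unfolding S_def
      by (intro image_eqI [of _ _ "mx @ my"]) (simp add: signed_sum_append, fastforce simp: T_def)
    show "x * y \<in> S"
      using mx my unfolding S_def
      unfolding mx(2) my(2) signed_sum_mult
      by (intro image_eqI [OF refl]) (fastforce simp: T_def)
  qed
  then obtain q where q: "\<And>i. i < n \<Longrightarrow> q i \<in> S" "\<exists>i<n. q i \<noteq> 0" "\<And>j. j < n \<Longrightarrow> (\<Sum>i<n. q i * P i j) = q j"
    by auto
  from q(1) have "\<forall>i. \<exists>m. i < n \<longrightarrow> m \<in> T \<and> q i = signed_sum (case_prod P) m"
    unfolding S_def by auto
  then obtain ms where ms: "\<And>i. i < n \<Longrightarrow> ms i \<in> T" "\<And>i. i < n \<Longrightarrow> q i = signed_sum (case_prod P) (ms i)"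
    by metis
  define ms' where "ms' i = (if i < n then ms i else [])" for i
  have ms': "ms' i \<in> T" "i < n \<Longrightarrow> signed_sum (case_prod P) (ms' i) = q i" for i
    using ms [of i] by (simp_all add: ms'_def) (simp add: T_def)
  have "\<exists>i<n. signed_sum (case_prod P) (ms' i) \<noteq> 0"
    using q(2) ms'(2) by metis
  moreover have "\<forall>j<n. (\<Sum>i<n. signed_sum (case_prod P) (ms' i) * P i j) = signed_sum (case_prod P) (ms' j)"
    using q(3) ms'(2) by simp
  ultimately show ?thesis
    using ms'(1) by (intro exI [of _ ms']) (auto simp: T_def)
qed

lemma pow_mat_Suc_entry:
  assumes "A \<in> carrier_mat n n" "i < n" "j < n"
  shows "(A ^\<^sub>m Suc m) $$ (i, j) = (\<Sum>k = 0..<n. (A ^\<^sub>m m) $$ (i, k) * A $$ (k, j))"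
proof -
  have "A ^\<^sub>m m \<in> carrier_mat n n" using assms(1) by (rule pow_carrier_mat)
  then show ?thesis using assms by (simp add: scalar_prod_def)
qed

lemma irreducible_connected_weights:
  assumes A: "irreducible_matrix A" and P: "stochastic_for A P"
  shows "connected_weights (dim_row A) (\<lambda>i j. P $$ (i, j))"
  unfolding connected_weights_def
proof (intro conjI allI impI)
  let ?n = "dim_row A"
  have sq: "A \<in> carrier_mat ?n ?n"
    using A by (auto simp: irreducible_matrix_def square_mat.simps)
  then have dim: "dim_col A = ?n" by (rule carrier_matD)
  show "0 \<le> P $$ (i, j)" if "i < ?n" "j < ?n" for i j
    using P that unfolding stochastic_for_def dim by blast
  fix S assume S: "S \<subseteq> {..<?n} \<and> S \<noteq> {} \<and> (\<forall>i\<in>S. \<forall>j<?n. 0 < P $$ (i, j) \<longrightarrow> j \<in> S)"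
  have step: "j \<in> S" if "i \<in> S" "j < ?n" "A $$ (i, j) \<noteq> 0" for i j
  proof -
    have "i < ?n" using that S by auto
    then have "P $$ (i, j) > 0"
      using P that unfolding stochastic_for_def dim by (metis order_le_less)
    then show ?thesis using S that by blast
  qed
  have reach: "j \<in> S" if "i \<in> S" "j < ?n" "(A ^\<^sub>m m) $$ (i, j) > 0" for i j m
    using that(2,3)
  proof (induction m arbitrary: j)
    case 0
    then have "i = j" using that(1) S by (auto simp: one_mat_def split: if_splits)
    then show ?case using that by simp
  next
    case (Suc m)
    have i: "i < ?n" using that S by auto
    note pow_mat_Suc_entry [OF sq i Suc.prems(1), of m]
    with Suc.prems(2) obtain k where k: "k < ?n" "(A ^\<^sub>m m) $$ (i, k) * A $$ (k, j) \<noteq> 0"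
      by (metis (no_types, lifting) atLeastLessThan_iff less_numeral_extra(3) sum.neutral)
    then have "k \<in> S" using Suc.IH [of k] by simp
    then show ?case using step [of k j] Suc.prems k by simp
  qed
  from S obtain i where i: "i \<in> S" by auto
  have "j \<in> S" if "j < ?n" for j
  proof -
    have "i < ?n" using i S by auto
    with that A obtain m where "(A ^\<^sub>m m) $$ (i, j) > 0"
      unfolding irreducible_matrix_def by blast
    then show ?thesis using reach [OF i \<open>j < ?n\<close>] by blast
  qed
  then show "S = {..<?n}" using S by auto
qed

section \<open>Weights of words as a weighted automaton\<close>

definition words :: "nat \<Rightarrow> nat \<Rightarrow> nat list set" where
  "words n l = {a. length a = l \<and> set a \<subseteq> {..<n}}"

lemma finite_words [simp]: "finite (words n l)"
  using finite_lists_length_eq [of "{..<n}" l] by (simp add: words_def conj_commute)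

text \<open>
  The block map \<open>\<Phi>\<close>, whose windows have length \<open>d + 1\<close>, turns the first \<open>length w\<close> windows of \<open>a\<close> into \<open>w\<close>.
\<close>

definition reads :: "(nat list \<Rightarrow> nat) \<Rightarrow> nat \<Rightarrow> nat list \<Rightarrow> nat list \<Rightarrow> bool" where
  "reads \<Phi> d a w \<longleftrightarrow> (\<forall>i<length w. \<Phi> (take (Suc d) (drop i a)) = w ! i)"

definition path_weight :: "(nat \<Rightarrow> real) \<Rightarrow> (nat \<Rightarrow> nat \<Rightarrow> real) \<Rightarrow> nat list \<Rightarrow> real" where
  "path_weight p P a = p (a ! 0) * (\<Prod>i<length a - 1. P (a ! i) (a ! Suc i))"

text \<open>
  A preimage of \<open>w\<close> is one letter longer than what has to be read in order to obtain \<open>w\<close>, so that it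
  ends in a window which has not been read yet.  This window is the state of the automaton after
  \<open>w\<close>, and the empty word is no exception.
\<close>

definition preimage_words :: "nat \<Rightarrow> (nat list \<Rightarrow> nat) \<Rightarrow> nat \<Rightarrow> nat list \<Rightarrow> nat list set" where
  "preimage_words n \<Phi> d w = {a \<in> words n (length w + Suc d). reads \<Phi> d a w}"

definition word_weight :: "nat \<Rightarrow> (nat \<Rightarrow> real) \<Rightarrow> (nat \<Rightarrow> nat \<Rightarrow> real) \<Rightarrow> (nat list \<Rightarrow> nat) \<Rightarrow> nat \<Rightarrow> nat list \<Rightarrow> real" where
  "word_weight n p P \<Phi> d w = (\<Sum>a\<in>preimage_words n \<Phi> d w. path_weight p P a)"

text \<open>
  The states are windows: the letter \<open>b\<close> is read off the window which is being left, and the new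
  window overlaps the old one in all but one letter.
\<close>

definition window_transition :: "(nat \<Rightarrow> nat \<Rightarrow> real) \<Rightarrow> (nat list \<Rightarrow> nat) \<Rightarrow> nat \<Rightarrow> nat list \<Rightarrow> nat list \<Rightarrow> real" where
  "window_transition P \<Phi> b x y = (if \<Phi> x = b \<and> tl x = butlast y then P (last x) (last y) else 0)"

lemma finite_preimage_words [simp]: "finite (preimage_words n \<Phi> d w)"
  by (simp add: preimage_words_def)

lemma path_weight_snoc:
  assumes "a \<noteq> []"
  shows "path_weight p P (a @ [c]) = path_weight p P a * P (last a) c"
proof -
  obtain m where m: "length a = Suc m" using assms by (cases a) auto
  have "(\<Prod>i<m. P ((a @ [c]) ! i) ((a @ [c]) ! Suc i)) = (\<Prod>i<m. P (a ! i) (a ! Suc i))"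
    using m by (intro prod.cong) (auto simp: nth_append)
  then show ?thesis
    using m assms by (auto simp: path_weight_def nth_append last_conv_nth)
qed

lemma reads_snoc:
  assumes "length a = length w + Suc d"
  shows "reads \<Phi> d (a @ [c]) (w @ [b]) \<longleftrightarrow> reads \<Phi> d a w \<and> \<Phi> (drop (length w) a) = b"
  using assms by (auto simp: reads_def less_Suc_eq nth_append)

text \<open>
  By induction on \<open>w\<close>, the vector reached after \<open>w\<close> has as its \<open>y\<close>-component the weight of all
  preimages of \<open>w\<close> that end in the window \<open>y\<close>: a preimage of \<open>w @ [b]\<close> is a preimage of \<open>w\<close> followed by
  the last letter of \<open>y\<close>.
\<close>

lemma word_weight_automaton:
  "word_weight n p P \<Phi> d w =
    pairing (words n (Suc d)) (path_weight p P)
      (foldr (weighted_automaton.backward (words n (Suc d)) (window_transition P \<Phi>)) w (\<lambda>_. 1))"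
proof -
  let ?Q = "words n (Suc d)"
  let ?W = "preimage_words n \<Phi> d"
  interpret weighted_automaton ?Q "window_transition P \<Phi>"
    by unfold_locales simp
  have drop_mem: "drop (length w) a \<in> ?Q" if "a \<in> ?W w" for a w
    using that set_drop_subset [of "length w" a] by (auto simp: preimage_words_def words_def)
  have after: "after (path_weight p P) w y = (\<Sum>a\<in>{a \<in> ?W w. drop (length w) a = y}. path_weight p P a)"
    if "y \<in> ?Q" for y
    using that
  proof (induction w arbitrary: y rule: rev_induct)
    case Nil
    then have "{a \<in> ?W []. drop (length []) a = y} = {y}"
      by (auto simp: preimage_words_def reads_def)
    then show ?case by simp
  next
    case (snoc b w)
    let ?t = "\<lambda>a. path_weight p P a * window_transition P \<Phi> b (drop (length w) a) y"
    have "after (path_weight p P) (w @ [b]) y =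
        (\<Sum>x\<in>?Q. after (path_weight p P) w x * window_transition P \<Phi> b x y)"
      by (simp add: forward_def)
    also have "\<dots> = (\<Sum>x\<in>?Q. \<Sum>a\<in>{a \<in> ?W w. drop (length w) a = x}. ?t a)"
      by (intro sum.cong refl) (simp add: snoc.IH sum_distrib_right)
    also have "\<dots> = (\<Sum>a\<in>?W w. ?t a)"
      using drop_mem by (intro sum.group) auto
    also have "\<dots> = (\<Sum>a\<in>{a \<in> ?W w. \<Phi> (drop (length w) a) = b \<and> tl (drop (length w) a) = butlast y}. ?t a)"
      by (intro sum.mono_neutral_right) (auto simp: window_transition_def)
    also have "\<dots> = (\<Sum>a\<in>{a \<in> ?W (w @ [b]). drop (length (w @ [b])) a = y}. path_weight p P a)"
    proof (rule sum.reindex_bij_witness [where i = butlast and j = "\<lambda>a. a @ [last y]"])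
      have "length y = Suc d" "set y \<subseteq> {..<n}" using snoc.prems by (auto simp: words_def)
      moreover from this have "y \<noteq> []" by auto
      ultimately have y: "length y = Suc d" "set y \<subseteq> {..<n}" "y \<noteq> []" "last y < n"
        using last_in_set [of y] by blast+
      fix a assume a: "a \<in> {a \<in> ?W w. \<Phi> (drop (length w) a) = b \<and> tl (drop (length w) a) = butlast y}"
      then have len: "length a = length w + Suc d" by (simp add: preimage_words_def words_def)
      show "butlast (a @ [last y]) = a" by simp
      have "drop (length (w @ [b])) (a @ [last y]) = tl (drop (length w) a) @ [last y]"
        using len by (simp add: drop_Suc tl_drop)
      also have "\<dots> = y" using a y by simp
      finally show "a @ [last y] \<in> {a \<in> ?W (w @ [b]). drop (length (w @ [b])) a = y}"
        using a y by (auto simp: preimage_words_def words_def reads_snoc)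
      have "a \<noteq> []" "last (drop (length w) a) = last a" using len by auto
      then show "path_weight p P (a @ [last y]) = ?t a"
        using a by (simp add: path_weight_snoc window_transition_def)
    next
      fix a assume a: "a \<in> {a \<in> ?W (w @ [b]). drop (length (w @ [b])) a = y}"
      then have len: "length a = Suc (length w) + Suc d" by (simp add: preimage_words_def words_def)
      then have ne: "a \<noteq> []" by auto
      have y: "y = drop (Suc (length w)) a" using a by simp
      then have last: "last y = last a" using len by simp
      show snoc_a: "butlast a @ [last y] = a" using ne last by simp
      have "butlast y = tl (drop (length w) (butlast a))"
        using y by (simp add: butlast_drop drop_Suc tl_drop butlast_tl)
      moreover have "reads \<Phi> d (butlast a @ [last y]) (w @ [b])"
        unfolding snoc_a using a by (simp add: preimage_words_def)
      ultimately show "butlast a \<in> {a \<in> ?W w. \<Phi> (drop (length w) a) = b \<and> tl (drop (length w) a) = butlast y}"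
        using a len by (auto simp: preimage_words_def words_def reads_snoc dest: in_set_butlastD)
    qed
    finally show ?case .
  qed
  have "word_weight n p P \<Phi> d w = (\<Sum>y\<in>?Q. \<Sum>a\<in>{a \<in> ?W w. drop (length w) a = y}. path_weight p P a)"
    unfolding word_weight_def using drop_mem by (intro sum.group [symmetric]) auto
  also have "\<dots> = pairing ?Q (after (path_weight p P) w) (\<lambda>_. 1)"
    unfolding pairing_def by (intro sum.cong) (simp_all add: after)
  finally show ?thesis by (simp add: pairing_after)
qed

section \<open>Windows and cylinders\<close>

definition window :: "(int \<Rightarrow> nat) \<Rightarrow> int \<Rightarrow> nat \<Rightarrow> nat list" where
  "window x m l = map (\<lambda>i. x (m + int i)) [0..<l]"

lemma length_window [simp]: "length (window x m l) = l"
  by (simp add: window_def)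

lemma nth_window [simp]: "i < l \<Longrightarrow> window x m l ! i = x (m + int i)"
  by (simp add: window_def)

lemma segment_eq_window: "segment x a b = window x a (nat (b - a + 1))"
  by (intro nth_equalityI) (auto simp: segment_def nth_upto)

lemma window_append: "window x m (k + l) = window x m k @ window x (m + int k) l"
  by (rule nth_equalityI) (auto simp: nth_append add.assoc)

lemma take_drop_window: "i + k \<le> l \<Longrightarrow> take k (drop i (window x m l)) = window x (m + int i) k"
  by (rule nth_equalityI) (auto simp: add.assoc)

lemma window_shift: "window (shift x) m l = window x (m + 1) l"
  by (rule nth_equalityI) (auto simp: shift_def algebra_simps)

lemma block_code_eq_window: "block_code s t \<Phi> x i = \<Phi> (window x (i - int s) (Suc (s + t)))"
proof -
  have "nat (i + int t - (i - int s) + 1) = Suc (s + t)" by simp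
  then show ?thesis by (simp add: block_code_def segment_eq_window)
qed

lemma window_block_code:
  "window (block_code s t \<Phi> x) m (length w) = w \<longleftrightarrow>
    reads \<Phi> (s + t) (window x (m - int s) (length w + Suc (s + t))) w"
proof -
  have "reads \<Phi> (s + t) (window x (m - int s) (length w + Suc (s + t))) w \<longleftrightarrow>
      (\<forall>i<length w. \<Phi> (window x (m - int s + int i) (Suc (s + t))) = w ! i)"
    unfolding reads_def by (intro all_cong) (simp add: take_drop_window del: take_Suc)
  also have "\<dots> \<longleftrightarrow> (\<forall>i<length w. block_code s t \<Phi> x (m + int i) = w ! i)"
    by (simp add: block_code_eq_window algebra_simps)
  also have "\<dots> \<longleftrightarrow> window (block_code s t \<Phi> x) m (length w) = w"
    by (auto simp: list_eq_iff_nth_eq)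
  finally show ?thesis by blast
qed

text \<open>
  The alphabet is discrete, so fixing finitely many coordinates is an open condition.
\<close>

lemma open_cylinder: "open {x. window x m l = a}"
proof (cases "length a = l")
  case True
  have "open {x :: int \<Rightarrow> nat. x j = c}" for j c
    using open_vimage [OF discrete_topology_class.open_discrete [of "{c}"] continuous_on_product_coordinates [of j]]
    by (simp add: vimage_def)
  then have "open (\<Inter>i<l. {x :: int \<Rightarrow> nat. x (m + int i) = a ! i})"
    by (intro open_INT) auto
  moreover have "{x. window x m l = a} = (\<Inter>i<l. {x. x (m + int i) = a ! i})"
    using True by (auto simp: list_eq_iff_nth_eq)
  ultimately show ?thesis by simp
next
  case False
  then have "{x. window x m l = a} = {}" by (metis (mono_tags) Collect_empty_eq length_window)
  then show ?thesis by simp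
qed

lemma continuous_block_code: "continuous_on UNIV (block_code s t \<Phi>)"
proof (intro continuous_on_coordinatewise_then_product)
  fix i
  have "open ((\<lambda>x. block_code s t \<Phi> x i) -` B)" for B
  proof -
    have "(\<lambda>x. block_code s t \<Phi> x i) -` B =
        (\<Union>a\<in>\<Phi> -` B. {x. window x (i - int s) (Suc (s + t)) = a})"
      by (auto simp: block_code_eq_window)
    then show ?thesis by (auto intro!: open_UN open_cylinder)
  qed
  then show "continuous_on UNIV (\<lambda>x. block_code s t \<Phi> x i)"
    by (simp add: continuous_on_open_vimage)
qed

lemma continuous_shift: "continuous_on UNIV shift"
  unfolding shift_def by (intro continuous_on_coordinatewise_then_product) simp

lemma compact_bounded_sequences: "compact {x :: int \<Rightarrow> nat. \<forall>i. x i < n}"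
proof -
  have "compactin (product_topology (\<lambda>i :: int. euclidean :: nat topology) UNIV) (PiE UNIV (\<lambda>_. {..<n}))"
    unfolding compactin_PiE by (auto intro: finite_imp_compact)
  moreover have "PiE UNIV (\<lambda>_ :: int. {..<n}) = {x. \<forall>i. x i < n}" by auto
  ultimately show ?thesis by (simp add: euclidean_product_topology)
qed

text \<open>
  A product of discrete spaces is Hausdorff.
\<close>

lemma compact_imp_closed_sequences:
  fixes Y :: "(int \<Rightarrow> nat) set"
  assumes "compact Y"
  shows "closed Y"
proof -
  have "Hausdorff_space (product_topology (\<lambda>i :: int. euclidean :: nat topology) UNIV)"
    unfolding Hausdorff_space_product_topology
  proof (intro disjI2 ballI)
    show "Hausdorff_space (euclidean :: nat topology)"
      unfolding Hausdorff_space_def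
      by (auto simp: discrete_topology_class.open_discrete disjnt_def
          intro: exI [of _ "{x}" for x])
  qed
  then show ?thesis
    using compactin_imp_closedin [of euclidean Y] assms by (simp add: euclidean_product_topology)
qed

lemma inj_shift: "inj shift"
  by (rule inj_on_inverseI [of _ "\<lambda>x i. x (i - 1)"]) (simp add: shift_def)

section \<open>Hidden Markov chains\<close>

locale hidden_markov_chain =
  fixes n :: nat and \<Omega> :: "(int \<Rightarrow> nat) set" and \<mu> :: "(int \<Rightarrow> nat) measure"
    and p :: "nat \<Rightarrow> real" and P :: "nat \<Rightarrow> nat \<Rightarrow> real"
    and s t :: nat and \<Phi> :: "nat list \<Rightarrow> nat"
  assumes closed_\<Omega>: "closed \<Omega>"
    and shift_\<Omega>: "shift ` \<Omega> = \<Omega>"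
    and letters_\<Omega>: "x \<in> \<Omega> \<Longrightarrow> x i < n"
    and invariant: "invariant_prob \<Omega> \<mu>"
    and path_measure: "length a = Suc k \<Longrightarrow> set a \<subseteq> {..<n} \<Longrightarrow>
      measure \<mu> {x \<in> \<Omega>. segment x 0 (int k) = a} = path_weight p P a"
begin

abbreviation \<phi> :: "(int \<Rightarrow> nat) \<Rightarrow> (int \<Rightarrow> nat)" where
  "\<phi> \<equiv> block_code s t \<Phi>"

abbreviation Y :: "(int \<Rightarrow> nat) set" where
  "Y \<equiv> \<phi> ` \<Omega>"

abbreviation \<nu> :: "(int \<Rightarrow> nat) measure" where
  "\<nu> \<equiv> image_measure \<phi> \<mu>"

abbreviation weight :: "nat list \<Rightarrow> real" where
  "weight \<equiv> word_weight n p P \<Phi> (s + t)"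

lemma prob_space_\<mu>: "prob_space \<mu>" and space_\<mu> [simp]: "space \<mu> = \<Omega>"
  and sets_\<mu>: "sets \<mu> = sets (restrict_space borel \<Omega>)"
  and measure_shift: "E \<in> sets \<mu> \<Longrightarrow> measure \<mu> (shift -` E \<inter> \<Omega>) = measure \<mu> E"
  using invariant by (auto simp: invariant_prob_def)

sublocale \<mu>: prob_space \<mu> by (rule prob_space_\<mu>)

lemma shift_mem: "shift x \<in> \<Omega> \<longleftrightarrow> x \<in> \<Omega>"
  using shift_\<Omega> inj_shift by (metis inj_image_mem_iff)

lemma cylinder_in_sets: "{x \<in> \<Omega>. window x m l = a} \<in> sets \<mu>"
proof -
  have "{x \<in> \<Omega>. window x m l = a} = \<Omega> \<inter> {x. window x m l = a}" by auto
  then show ?thesis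
    unfolding sets_\<mu> sets_restrict_space using open_cylinder by auto
qed

lemma measure_cylinder:
  assumes "a \<in> words n (Suc k)"
  shows "measure \<mu> {x \<in> \<Omega>. window x m (Suc k) = a} = path_weight p P a"
proof -
  have shift: "measure \<mu> {x \<in> \<Omega>. window x (m + 1) (Suc k) = a} = measure \<mu> {x \<in> \<Omega>. window x m (Suc k) = a}" for m
  proof -
    have "shift -` {x \<in> \<Omega>. window x m (Suc k) = a} \<inter> \<Omega> = {x \<in> \<Omega>. window x (m + 1) (Suc k) = a}"
      by (auto simp: shift_mem window_shift)
    then show ?thesis using measure_shift [OF cylinder_in_sets, of m "Suc k" a] by simp
  qed
  show ?thesis
  proof (induction m rule: int_induct [of _ 0])
    case base
    have "window x 0 (Suc k) = segment x 0 (int k)" for x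
      by (simp add: segment_eq_window nat_add_distrib)
    then show ?case using path_measure [of a k] assms by (simp add: words_def)
  next
    case (step1 i)
    then show ?case using shift [of i] by simp
  next
    case (step2 i)
    then show ?case using shift [of "i - 1"] by simp
  qed
qed

lemma \<phi>_measurable: "\<phi> \<in> measurable \<mu> (restrict_space borel Y)"
proof -
  have "\<phi> \<in> measurable (borel :: (int \<Rightarrow> nat) measure) borel"
    by (intro borel_measurable_continuous_onI continuous_block_code)
  then have "\<phi> \<in> measurable (restrict_space borel \<Omega>) (restrict_space borel Y)"
    by (intro measurable_restrict_space3) auto
  then show ?thesis using measurable_cong_sets [OF sets_\<mu> refl] by blast
qed

lemma space_\<nu> [simp]: "space \<nu> = Y"
  by (simp add: image_measure_def space_restrict_space)

lemma sets_\<nu>: "sets \<nu> = sets (restrict_space borel Y)"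
  by (simp add: image_measure_def)

lemma measure_\<nu>: "E \<in> sets \<nu> \<Longrightarrow> measure \<nu> E = measure \<mu> (\<phi> -` E \<inter> \<Omega>)"
  using measure_distr [OF \<phi>_measurable] by (simp add: image_measure_def)

sublocale \<nu>: prob_space \<nu>
  unfolding image_measure_def space_\<mu> by (rule \<mu>.prob_space_distr [OF \<phi>_measurable])

lemma image_cylinder_in_sets: "{y \<in> Y. window y m l = w} \<in> sets \<nu>"
proof -
  have "{x \<in> Y. window x m l = w} = Y \<inter> {x. window x m l = w}" by auto
  then show ?thesis
    unfolding sets_\<nu> sets_restrict_space using open_cylinder by auto
qed

text \<open>
  The cylinder of \<open>w\<close> in the image is the disjoint union of the cylinders of the preimages of \<open>w\<close>.
\<close>

theorem measure_image_cylinder: "measure \<nu> {y \<in> Y. window y m (length w) = w} = weight w"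
proof -
  let ?l = "length w + Suc (s + t)"
  let ?C = "\<lambda>a. {x \<in> \<Omega>. window x (m - int s) ?l = a}"
  have "set (window x (m - int s) ?l) \<subseteq> {..<n}" if "x \<in> \<Omega>" for x
    using letters_\<Omega> [OF that] by (auto simp: window_def)
  then have "\<phi> -` {y \<in> Y. window y m (length w) = w} \<inter> \<Omega> =
      (\<Union>a\<in>preimage_words n \<Phi> (s + t) w. ?C a)"
    by (auto simp: window_block_code preimage_words_def words_def)
  then have "measure \<nu> {y \<in> Y. window y m (length w) = w} =
      measure \<mu> (\<Union>a\<in>preimage_words n \<Phi> (s + t) w. ?C a)"
    using measure_\<nu> [OF image_cylinder_in_sets] by simp
  also have "\<dots> = (\<Sum>a\<in>preimage_words n \<Phi> (s + t) w. measure \<mu> (?C a))"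
    using cylinder_in_sets by (intro \<mu>.finite_measure_finite_Union) (auto simp: disjoint_family_on_def)
  also have "\<dots> = weight w"
    unfolding word_weight_def
    using measure_cylinder by (intro sum.cong) (auto simp: preimage_words_def)
  finally show ?thesis .
qed

lemma weight_nonneg: "weight w \<ge> 0"
  unfolding measure_image_cylinder [of 0 w, symmetric] by (rule measure_nonneg)

lemma weight_infix_le: "weight (w @ u @ v) \<le> weight u"
proof -
  have "window y (int (length w)) (length u) = u" if "window y 0 (length (w @ u @ v)) = w @ u @ v" for y
    using that by (simp add: window_append)
  then have "measure \<nu> {y \<in> Y. window y 0 (length (w @ u @ v)) = w @ u @ v} \<le>
      measure \<nu> {y \<in> Y. window y (int (length w)) (length u) = u}"
    by (intro \<nu>.finite_measure_mono image_cylinder_in_sets) auto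
  then show ?thesis unfolding measure_image_cylinder .
qed

lemma weight_null: "weight u = 0 \<Longrightarrow> weight (w @ u @ v) = 0"
  using weight_infix_le [of w u v] weight_nonneg [of "w @ u @ v"] by simp

sublocale automaton: positive_automaton "words n (Suc (s + t))" "window_transition P \<Phi>"
    "path_weight p P" "\<lambda>_. 1"
proof (unfold_locales)
  show "finite (words n (Suc (s + t)))" by simp
  interpret weighted_automaton "words n (Suc (s + t))" "window_transition P \<Phi>"
    by unfold_locales simp
  show "pairing (words n (Suc (s + t))) (path_weight p P) (before (w @ u @ v) (\<lambda>_. 1)) = 0"
    if "pairing (words n (Suc (s + t))) (path_weight p P) (before u (\<lambda>_. 1)) = 0" for w u v
    using weight_null that unfolding word_weight_automaton .
qed

lemma automaton_\<nu>: "automaton.\<nu> = weight"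
  by (simp add: fun_eq_iff automaton.\<nu>_def word_weight_automaton)

definition alphabet :: "nat set" where
  "alphabet = \<Phi> ` words n (Suc (s + t))"

lemma finite_alphabet: "finite alphabet"
  by (simp add: alphabet_def)

lemma window_mem_words: "x \<in> \<Omega> \<Longrightarrow> window x m l \<in> words n l"
  using letters_\<Omega> by (auto simp: words_def window_def)

lemma letters_Y: "y \<in> Y \<Longrightarrow> y i \<in> alphabet"
  unfolding alphabet_def block_code_eq_window using window_mem_words by blast

lemma weight_outside_alphabet: "b \<notin> alphabet \<Longrightarrow> weight (w @ b # v) = 0"
proof -
  assume b: "b \<notin> alphabet"
  have "window y 0 (length (w @ b # v)) \<noteq> w @ b # v" if "y \<in> Y" for y
  proof
    assume eq: "window y 0 (length (w @ b # v)) = w @ b # v"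
    have "y (0 + int (length w)) = window y 0 (length (w @ b # v)) ! length w"
      by (rule nth_window [symmetric]) simp
    also have "\<dots> = b" unfolding eq by simp
    finally show False using b letters_Y [OF that, of "0 + int (length w)"] by simp
  qed
  then have "{y \<in> Y. window y 0 (length (w @ b # v)) = w @ b # v} = {}" by blast
  then show ?thesis using measure_image_cylinder [of 0 "w @ b # v"] by (metis measure_empty)
qed

text \<open>
  Additivity of the image measure over all continuations of a fixed length.
\<close>

lemma sum_weight_extensions:
  "(\<Sum>v\<in>{v. set v \<subseteq> alphabet \<and> length v = l}. weight (w @ v)) = weight w"
proof -
  let ?V = "{v. set v \<subseteq> alphabet \<and> length v = l}"
  let ?C = "\<lambda>v. {y \<in> Y. window y 0 (length (w @ v)) = w @ v}"
  have "set (window y m l) \<subseteq> alphabet" if "y \<in> Y" for y m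
    using letters_Y [OF that] by (auto simp: window_def)
  then have "{y \<in> Y. window y 0 (length w) = w} = (\<Union>v\<in>?V. ?C v)"
    by (auto simp: window_append)
  then have "weight w = measure \<nu> (\<Union>v\<in>?V. ?C v)"
    using measure_image_cylinder [of 0 w] by simp
  also have "\<dots> = (\<Sum>v\<in>?V. measure \<nu> (?C v))"
    using image_cylinder_in_sets finite_lists_length_eq [OF finite_alphabet, of l]
    by (intro \<nu>.finite_measure_finite_Union) (auto simp: disjoint_family_on_def)
  finally show ?thesis unfolding measure_image_cylinder ..
qed

lemma shift_\<phi>: "shift (\<phi> x) = \<phi> (shift x)"
  by (rule ext) (simp add: shift_def [of "\<phi> x"] block_code_eq_window window_shift algebra_simps)

lemma subshift_Y: "subshift Y"
  unfolding subshift_def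
proof (intro conjI)
  have "\<Omega> = \<Omega> \<inter> {x. \<forall>i. x i < n}" using letters_\<Omega> by auto
  then have "compact \<Omega>"
    using closed_Int_compact [OF closed_\<Omega> compact_bounded_sequences] by metis
  then have "compact Y"
    by (intro compact_continuous_image continuous_on_subset [OF continuous_block_code]) auto
  then show "closed Y" by (rule compact_imp_closed_sequences)
  have "shift ` Y = \<phi> ` (shift ` \<Omega>)" by (auto simp: image_image shift_\<phi>)
  then show "shift ` Y = Y" by (simp add: shift_\<Omega>)
  show "\<exists>S. finite S \<and> (\<forall>y\<in>Y. range y \<subseteq> S)"
    using finite_alphabet letters_Y by (intro exI [of _ alphabet]) auto
qed

lemma invariant_\<nu>: "invariant_prob Y \<nu>"
  unfolding invariant_prob_def
proof (intro conjI ballI)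
  show "prob_space \<nu>" by unfold_locales
  show "space \<nu> = Y" by simp
  show "sets \<nu> = sets (restrict_space borel Y)" by (rule sets_\<nu>)
  fix E assume E: "E \<in> sets \<nu>"
  have "shift \<in> measurable (borel :: (int \<Rightarrow> nat) measure) borel"
    by (intro borel_measurable_continuous_onI continuous_shift)
  moreover have "shift ` Y = Y" using subshift_Y by (simp add: subshift_def)
  ultimately have "shift \<in> measurable (restrict_space borel Y) (restrict_space borel Y)"
    by (intro measurable_restrict_space3) auto
  then have "shift \<in> measurable \<nu> \<nu>"
    using measurable_cong_sets [OF sets_\<nu> sets_\<nu>] by blast
  from measurable_sets [OF this E] have "shift -` E \<inter> Y \<in> sets \<nu>" by simp
  then have "measure \<nu> (shift -` E \<inter> Y) = measure \<mu> (\<phi> -` (shift -` E \<inter> Y) \<inter> \<Omega>)"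
    by (rule measure_\<nu>)
  also have "\<phi> -` (shift -` E \<inter> Y) \<inter> \<Omega> = shift -` (\<phi> -` E \<inter> \<Omega>) \<inter> \<Omega>"
    by (auto simp: shift_mem simp flip: shift_\<phi>)
  also have "measure \<mu> \<dots> = measure \<mu> (\<phi> -` E \<inter> \<Omega>)"
  proof (rule measure_shift)
    have "E \<in> sets (restrict_space borel Y)" using E by (simp add: sets_\<nu>)
    from measurable_sets [OF \<phi>_measurable this] show "\<phi> -` E \<inter> \<Omega> \<in> sets \<mu>" by simp
  qed
  also have "\<dots> = measure \<nu> E" using measure_\<nu> [OF E] by simp
  finally show "measure \<nu> (shift -` E \<inter> space \<nu>) = measure \<nu> E" by simp
qed

lemma cond_prob_weight:
  "\<P>(y in \<nu>. window y 0 (length v) = v \<bar> window y (- int (length w)) (length w) = w) =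
    weight (w @ v) / weight w"
proof -
  have "{y \<in> space \<nu>. window y 0 (length v) = v \<and> window y (- int (length w)) (length w) = w} =
      {y \<in> Y. window y (- int (length w)) (length (w @ v)) = w @ v}"
    by (auto simp: window_append)
  then show ?thesis
    unfolding cond_prob_def by (simp only: measure_image_cylinder space_\<nu>)
qed

text \<open>
  The Markov property constrains \<open>w @ u @ v\<close> only if this word occurs in \<open>Y\<close>.  If it does not, while
  \<open>w @ u\<close> has positive weight, one has to exclude that \<open>u @ v\<close> has positive weight.  In any case
  \<open>weight (w @ u @ v) * weight u \<le> weight (w @ u) * weight (u @ v)\<close>, and the sums of both sides over all
  \<open>v\<close> of one length agree, so all these inequalities are equalities.
\<close>

theorem k_step_markov_iff_splits:
  assumes k: "k \<ge> 1"
  shows "k_step_markov k Y \<nu> \<longleftrightarrow> (\<forall>u. length u = k \<longrightarrow> splits_at weight u)"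
proof
  assume "k_step_markov k Y \<nu>"
  then have markov: "\<P>(y in \<nu>. segment y 0 i = segment x 0 i \<bar> segment y (-j) (-1) = segment x (-j) (-1)) =
        \<P>(y in \<nu>. segment y 0 i = segment x 0 i \<bar> segment y (-int k) (-1) = segment x (-int k) (-1))"
    if "i \<ge> 0" "j \<ge> int k" "x \<in> Y" "measure \<nu> {y \<in> Y. segment y (-j) (-1) = segment x (-j) (-1)} > 0" for i j x
    using that unfolding k_step_markov_def space_\<nu> by blast
  have positive_split: "weight (w @ u @ v) * weight u = weight (w @ u) * weight (u @ v)"
    if u: "length u = k" and pos: "weight (w @ u @ v) > 0" for w u v
  proof (cases "v = []")
    case False
    let ?j = "int (length (w @ u))"
    have "{y \<in> Y. window y (- ?j) (length (w @ u @ v)) = w @ u @ v} \<noteq> {}"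
      using pos measure_image_cylinder [of "- ?j" "w @ u @ v"] by (metis less_irrefl measure_empty)
    then obtain x where x: "x \<in> Y" "window x (- ?j) (length (w @ u @ v)) = w @ u @ v" by blast
    then have wu: "window x (- ?j) (length (w @ u)) = w @ u"
      and u': "window x (- int (length u)) (length u) = u" and v: "window x 0 (length v) = v"
      using u by (auto simp: window_append)
    have segs: "segment y (- ?j) (-1) = window y (- ?j) (length (w @ u))"
      "segment y (- int k) (-1) = window y (- int (length u)) (length u)"
      "segment y 0 (int (length v) - 1) = window y 0 (length v)" for y
      using u by (auto simp: segment_eq_window nat_add_distrib)
    have "weight (w @ u) > 0"
      using weight_infix_le [of "[]" "w @ u" v] pos by simp
    then have "measure \<nu> {y \<in> Y. segment y (- ?j) (-1) = segment x (- ?j) (-1)} > 0"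
      unfolding segs wu measure_image_cylinder .
    moreover have "0 \<le> int (length v) - 1" "int k \<le> ?j"
      using False u by (auto simp: Suc_le_eq)
    ultimately have "weight ((w @ u) @ v) / weight (w @ u) = weight (u @ v) / weight u"
      using markov [of "int (length v) - 1" ?j x] x(1)
      unfolding segs wu u' v cond_prob_weight by blast
    moreover have "weight u > 0" using weight_infix_le [of w u v] pos by simp
    ultimately show ?thesis using \<open>weight (w @ u) > 0\<close> by (simp add: field_simps)
  qed simp
  show "\<forall>u. length u = k \<longrightarrow> splits_at weight u"
    unfolding splits_at_def
  proof (intro allI impI)
    fix u w v :: "nat list"
    assume u: "length u = k"
    show "weight (w @ u @ v) * weight u = weight (w @ u) * weight (u @ v)"
    proof (cases "weight (w @ u @ v) > 0")
      case True
      then show ?thesis by (rule positive_split [OF u])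
    next
      case False
      then have zero: "weight (w @ u @ v) = 0" using weight_nonneg [of "w @ u @ v"] by simp
      show ?thesis
      proof (cases "weight (w @ u) = 0 \<or> \<not> set v \<subseteq> alphabet")
        case True
        then show ?thesis
        proof
          assume "\<not> set v \<subseteq> alphabet"
          then obtain b v1 v2 where "v = v1 @ b # v2" "b \<notin> alphabet" by (meson subsetI split_list)
          then have "weight (u @ v) = 0" using weight_outside_alphabet [of b "u @ v1" v2] by simp
          then show ?thesis using zero by simp
        qed (simp add: zero)
      next
        case False
        let ?V = "{v'. set v' \<subseteq> alphabet \<and> length v' = length v}"
        have fin: "finite ?V" using finite_lists_length_eq [OF finite_alphabet] .
        have "v \<in> ?V" using False by simp
        have le: "weight (w @ u @ v') * weight u \<le> weight (w @ u) * weight (u @ v')" for v'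
          using positive_split [OF u, of w v'] weight_nonneg
          by (cases "weight (w @ u @ v') > 0") (auto simp: not_less intro: mult_nonneg_nonneg order_trans [OF mult_nonpos_nonneg])
        have "(\<Sum>v'\<in>?V. weight (w @ u) * weight (u @ v') - weight (w @ u @ v') * weight u) =
            weight (w @ u) * weight u - weight (w @ u) * weight u"
          using sum_weight_extensions [of u "length v"] sum_weight_extensions [of "w @ u" "length v"]
          by (simp add: sum_subtractf flip: sum_distrib_left sum_distrib_right)
        then have "(\<Sum>v'\<in>?V. weight (w @ u) * weight (u @ v') - weight (w @ u @ v') * weight u) = 0"
          by simp
        then have "\<forall>v'\<in>?V. weight (w @ u) * weight (u @ v') - weight (w @ u @ v') * weight u = 0"
          using le fin by (subst (asm) sum_nonneg_eq_0_iff) auto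
        then show ?thesis using \<open>v \<in> ?V\<close> by simp
      qed
    qed
  qed
next
  assume splits: "\<forall>u. length u = k \<longrightarrow> splits_at weight u"
  show "k_step_markov k Y \<nu>"
    unfolding k_step_markov_def
  proof (intro conjI allI ballI impI subshift_Y invariant_\<nu>)
    fix i j :: int and x
    assume i: "0 \<le> i" and j: "int k \<le> j" and x: "x \<in> Y"
      and pos: "0 < measure \<nu> {y \<in> space \<nu>. segment y (- j) (- 1) = segment x (- j) (- 1)}"
    define u where "u = window x (- int k) k"
    define w where "w = window x (- j) (nat j - k)"
    define v where "v = window x 0 (nat (i + 1))"
    have lens: "length u = k" "length w = nat j - k" "length v = nat (i + 1)"
      by (simp_all add: u_def w_def v_def)
    have len_wu: "int (length (w @ u)) = j" using lens j by simp
    have segs: "segment y (- j) (- 1) = window y (- int (length (w @ u))) (length (w @ u))"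
      "segment y (- int k) (- 1) = window y (- int (length u)) (length u)"
      "segment y 0 i = window y 0 (length v)" for y
      unfolding len_wu using lens j i len_wu by (auto simp: segment_eq_window)
    have x_segs: "window x (- int (length (w @ u))) (length (w @ u)) = w @ u"
      "window x (- int (length u)) (length u) = u" "window x 0 (length v) = v"
    proof -
      have "nat j - k + k = nat j" "- j + int (nat j - k) = - int k" using j by auto
      then have "window x (- j) (nat j) = w @ u"
        using window_append [of x "- j" "nat j - k" k] by (simp add: w_def u_def)
      moreover have "length (w @ u) = nat j" using len_wu by linarith
      ultimately show "window x (- int (length (w @ u))) (length (w @ u)) = w @ u"
        unfolding len_wu by simp
      show "window x (- int (length u)) (length u) = u" "window x 0 (length v) = v"
        using lens by (simp_all add: u_def v_def)
    qed
    have wu: "weight (w @ u) > 0"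
      using pos unfolding segs x_segs space_\<nu> measure_image_cylinder .
    then have u_pos: "weight u > 0" using weight_infix_le [of w u "[]"] by simp
    have "weight (w @ u @ v) * weight u = weight (w @ u) * weight (u @ v)"
      using splits lens by (simp add: splits_at_def)
    then have "weight ((w @ u) @ v) / weight (w @ u) = weight (u @ v) / weight u"
      using wu u_pos by (simp add: field_simps)
    then show "\<P>(y in \<nu>. segment y 0 i = segment x 0 i \<bar> segment y (- j) (- 1) = segment x (- j) (- 1)) =
        \<P>(y in \<nu>. segment y 0 i = segment x 0 i \<bar> segment y (- int k) (- 1) = segment x (- int k) (- 1))"
      unfolding segs x_segs cond_prob_weight .
  qed
qed

theorem is_markov_iff_splits_bounded:
  assumes b: "1 \<le> b" "card (words n (Suc (s + t))) * card (words n (Suc (s + t))) \<le> b"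
  shows "is_markov Y \<nu> \<longleftrightarrow> (\<forall>u. b \<le> length u \<longrightarrow> splits_at weight u)"
proof
  assume "is_markov Y \<nu>"
  then obtain k where k: "k \<ge> 1" "k_step_markov k Y \<nu>" by (auto simp: is_markov_def)
  then have "splits_at automaton.\<nu> u" if "length u = k" for u
    using that k_step_markov_iff_splits automaton_\<nu> by simp
  from automaton.splits_at_long_words [OF this] b(2)
  show "\<forall>u. b \<le> length u \<longrightarrow> splits_at weight u" by (simp add: automaton_\<nu>)
next
  assume "\<forall>u. b \<le> length u \<longrightarrow> splits_at weight u"
  then have "k_step_markov b Y \<nu>" using k_step_markov_iff_splits [OF b(1)] by simp
  then show "is_markov Y \<nu>" using b(1) by (auto simp: is_markov_def)
qed

text \<open>
  A bound \<open>b\<close> for the order of the chain also bounds the number of states, hence the lengths of the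
  contexts to be considered; with \<open>u\<close> of length \<open>b\<close> this leads to words of length at most \<open>3 * b\<close>.
  Testing more words than necessary does no harm, as all equations hold if the image is Markov.
\<close>

theorem is_markov_iff_finite_test:
  assumes b: "1 \<le> b" "card (words n (Suc (s + t))) * card (words n (Suc (s + t))) \<le> b"
    and alphabet: "alphabet \<subseteq> {..c}"
  shows "is_markov Y \<nu> \<longleftrightarrow> (\<forall>w u v. b \<le> length u \<and> length (w @ u @ v) \<le> 3 * b \<and> set (w @ u @ v) \<subseteq> {..c} \<longrightarrow>
    weight (w @ u @ v) * weight u = weight (w @ u) * weight (u @ v))"
proof
  assume "is_markov Y \<nu>"
  then show "\<forall>w u v. b \<le> length u \<and> length (w @ u @ v) \<le> 3 * b \<and> set (w @ u @ v) \<subseteq> {..c} \<longrightarrow>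
    weight (w @ u @ v) * weight u = weight (w @ u) * weight (u @ v)"
    unfolding is_markov_iff_splits_bounded [OF b] splits_at_def by blast
next
  assume test: "\<forall>w u v. b \<le> length u \<and> length (w @ u @ v) \<le> 3 * b \<and> set (w @ u @ v) \<subseteq> {..c} \<longrightarrow>
    weight (w @ u @ v) * weight u = weight (w @ u) * weight (u @ v)"
  have card_le: "card (words n (Suc (s + t))) \<le> b"
    using le_square b(2) by (rule le_trans)
  have "splits_at weight u" if u: "length u = b" for u
  proof (cases "u \<in> lists alphabet")
    case True
    have "splits_at automaton.\<nu> u"
    proof (rule automaton.splits_at_if_splits_short_contexts [OF _ True])
      show "automaton.\<nu> (w @ b # v) = 0" if "b \<notin> alphabet" for w b v
        unfolding automaton_\<nu> using that by (rule weight_outside_alphabet)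
      show "automaton.\<nu> (w @ u @ v) * automaton.\<nu> u = automaton.\<nu> (w @ u) * automaton.\<nu> (u @ v)"
        if "w \<in> lists alphabet" "v \<in> lists alphabet"
          "length w \<le> card (words n (Suc (s + t)))" "length v \<le> card (words n (Suc (s + t)))" for w v
        unfolding automaton_\<nu>
        using test [rule_format, of u w v] that True u card_le alphabet by auto
    qed
    then show ?thesis by (simp add: automaton_\<nu>)
  next
    case False
    then obtain c u1 u2 where c: "u = u1 @ c # u2" "c \<notin> alphabet"
      by (metis in_listsI split_list)
    then have "weight u = 0" "weight (w @ u) = 0" for w
      using weight_outside_alphabet [of c u1 u2] weight_outside_alphabet [of c "w @ u1" u2] by simp_all
    then show ?thesis by (simp add: splits_at_def)
  qed
  then show "is_markov Y \<nu>"
    using b(1) k_step_markov_iff_splits [OF b(1)] unfolding is_markov_def by blast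
qed

end

section \<open>The decision procedure\<close>

text \<open>
  The components of an input \<open>x\<close> are read off its code: the matrix of field codes, \<open>s\<close> and \<open>t\<close>, and the
  table of the block map are its entries 1 to 4.
\<close>

definition state_count :: "nat \<Rightarrow> nat" where
  "state_count x = word_length (entry x 1)"

definition memory :: "nat \<Rightarrow> nat" where
  "memory x = entry x 2 + entry x 3"

definition entry_code :: "nat \<Rightarrow> nat \<Rightarrow> nat \<Rightarrow> nat" where
  "entry_code x i j = entry (entry (entry x 1) i) j"

text \<open>
  \<open>c\<close> is to code a preimage of the subword of length \<open>l\<close> starting at position \<open>i\<close> of the word coded
  by \<open>b\<close>.  The block map is evaluated by looking for a matching line in its table.
\<close>

definition codes_preimage :: "nat \<Rightarrow> nat \<Rightarrow> nat \<Rightarrow> nat \<Rightarrow> nat \<Rightarrow> bool" where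
  "codes_preimage x c b i l \<longleftrightarrow>
     word_length c = l + Suc (memory x) \<and>
     (\<forall>k<word_length c. entry c k < state_count x) \<and>
     (\<forall>k<l. \<exists>j<word_length (entry x 4).
        (\<forall>r<Suc (memory x). entry (fst_code (entry (entry x 4) j)) r = entry c (k + r)) \<and>
        snd_code (entry (entry x 4) j) = entry b (i + k))"

text \<open>
  The square of the number of windows, incremented so as to be positive.
\<close>

definition test_bound :: "nat \<Rightarrow> nat" where
  "test_bound x = Suc (state_count x ^ Suc (memory x) * state_count x ^ Suc (memory x))"

lemmas computation_rules = recursive_rules decidable_basic

lemma recursive_state_count: "recursive f \<Longrightarrow> recursive (\<lambda>e. state_count (f e))"
  unfolding state_count_def by (intro computation_rules)

lemma recursive_memory: "recursive f \<Longrightarrow> recursive (\<lambda>e. memory (f e))"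
  unfolding memory_def by (intro computation_rules)

lemma recursive_entry_code:
  "recursive f \<Longrightarrow> recursive g \<Longrightarrow> recursive h \<Longrightarrow> recursive (\<lambda>e. entry_code (f e) (g e) (h e))"
  unfolding entry_code_def by (intro computation_rules)

lemma recursive_test_bound: "recursive f \<Longrightarrow> recursive (\<lambda>e. test_bound (f e))"
  unfolding test_bound_def by (intro computation_rules recursive_state_count recursive_memory)

lemma decidable_codes_preimage:
  assumes "recursive x" "recursive c" "recursive b" "recursive i" "recursive l"
  shows "decidable (\<lambda>e. codes_preimage (x e) (c e) (b e) (i e) (l e))"
  unfolding codes_preimage_def
  by (intro computation_rules recursive_state_count recursive_memory
      assms [THEN recursive_compose] assms)

context real_codes
begin

text \<open>
  Outside the matrix the coefficient is 0, so that every number codes a polynomial whose value can be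
  computed.
\<close>

definition coefficient :: "nat \<Rightarrow> nat \<Rightarrow> nat \<Rightarrow> real" where
  "coefficient x i j =
     (if i < state_count x \<and> j < state_count x then the (rep (entry_code x i j)) else 0)"

definition represented :: "nat \<Rightarrow> bool" where
  "represented x \<longleftrightarrow> (\<forall>i<state_count x. \<forall>j<state_count x. rep (entry_code x i j) \<noteq> None)"

definition monomial_value :: "nat \<Rightarrow> nat \<Rightarrow> real" where
  "monomial_value x c = (\<Prod>k<word_length c. coefficient x (fst_code (entry c k)) (snd_code (entry c k)))"

definition polynomial_value :: "nat \<Rightarrow> nat \<Rightarrow> real" where
  "polynomial_value x c = (\<Sum>k<word_length c.
     (\<Prod>i<fst_code (entry c k). - 1) * monomial_value x (snd_code (entry c k)))"

text \<open>
  \<open>m\<close> codes a list of polynomials whose values form a nonzero solution of \<open>qP = q\<close>.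
\<close>

definition codes_fixed_vector :: "nat \<Rightarrow> nat \<Rightarrow> bool" where
  "codes_fixed_vector x m \<longleftrightarrow>
     (\<forall>j<state_count x. (\<Sum>i<state_count x. polynomial_value x (entry m i) * coefficient x i j) =
        polynomial_value x (entry m j)) \<and>
     (\<exists>i<state_count x. polynomial_value x (entry m i) \<noteq> 0)"

definition code_weight :: "nat \<Rightarrow> nat \<Rightarrow> nat \<Rightarrow> nat \<Rightarrow> nat \<Rightarrow> real" where
  "code_weight x m b i l = (\<Sum>c<word_bound (state_count x) (l + Suc (memory x)).
     if codes_preimage x c b i l
     then polynomial_value x (entry m (entry c 0)) *
       (\<Prod>k<word_length c - 1. coefficient x (entry c k) (entry c (Suc k)))
     else 0)"

text \<open>
  Splitting the word coded by \<open>b\<close> at the positions \<open>i\<close>, \<open>j\<close> and \<open>l\<close> yields \<open>w\<close>, \<open>u\<close> and \<open>v\<close>; so no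
  concatenation has to be computed.
\<close>

definition markov_test :: "nat \<Rightarrow> nat \<Rightarrow> bool" where
  "markov_test x m \<longleftrightarrow>
     (\<forall>b<word_bound x (3 * test_bound x). \<forall>l<Suc (3 * test_bound x). \<forall>j<Suc l. \<forall>i<Suc j.
        i + test_bound x \<le> j \<longrightarrow>
        code_weight x m b 0 l * code_weight x m b i (j - i) =
        code_weight x m b 0 j * code_weight x m b i (l - i))"

lemma computable_coefficient:
  assumes rec: "recursive f" "recursive g" "recursive h" and D: "\<And>e. D e \<Longrightarrow> represented (f e)"
  shows "computable D (\<lambda>e. coefficient (f e) (g e) (h e))"
proof -
  obtain z where z: "rep z = Some 0"
    using field zero_in_K unfolding computable_field_def ran_def by auto
  show ?thesis
  proof (rule computable_code)
    show "recursive (\<lambda>e. if g e < state_count (f e) \<and> h e < state_count (f e)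
      then entry_code (f e) (g e) (h e) else z)"
      by (intro computation_rules recursive_state_count recursive_entry_code rec)
    show "rep (if g e < state_count (f e) \<and> h e < state_count (f e)
      then entry_code (f e) (g e) (h e) else z) = Some (coefficient (f e) (g e) (h e))" if "D e" for e
      using D [OF that] z by (auto simp: coefficient_def represented_def)
  qed
qed

lemma computable_polynomial_value:
  assumes rec: "recursive f" "recursive g" and D: "\<And>e. D e \<Longrightarrow> represented (f e)"
  shows "computable D (\<lambda>e. polynomial_value (f e) (g e))"
  unfolding polynomial_value_def monomial_value_def
  by (intro computable_sum computable_mult computable_prod computable_const minus_one_in_K
      computable_coefficient computation_rules rec [THEN recursive_compose] rec D)

lemma decidable_codes_fixed_vector:
  assumes D: "\<And>x. D x \<Longrightarrow> represented x"
  shows "decidable_on (\<lambda>z. D (fst_code z)) (\<lambda>z. codes_fixed_vector (fst_code z) (snd_code z))"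
  unfolding codes_fixed_vector_def
  by (intro decidable_on_conj decidable_on_ball_less decidable_on_bex_less decidable_on_not
      decidable_on_eq computable_sum computable_mult computable_const zero_in_K
      computable_polynomial_value computable_coefficient recursive_state_count computation_rules D)

lemma computable_code_weight:
  assumes rec: "recursive x" "recursive m" "recursive b" "recursive i" "recursive l"
    and D: "\<And>e. D e \<Longrightarrow> represented (x e)"
  shows "computable D (\<lambda>e. code_weight (x e) (m e) (b e) (i e) (l e))"
  unfolding code_weight_def
  by (intro computable_sum computable_if computable_mult computable_prod computable_const zero_in_K
      computable_polynomial_value computable_coefficient decidable_codes_preimage
      recursive_state_count recursive_memory computation_rules rec [THEN recursive_compose] rec D)

lemma decidable_markov_test:
  assumes D: "\<And>x. D x \<Longrightarrow> represented x"
  shows "decidable_on (\<lambda>z. D (fst_code z) \<and> W z) (\<lambda>z. markov_test (fst_code z) (snd_code z))"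
  unfolding markov_test_def
  by (intro decidable_on_ball_less decidable_on_imp decidable_imp_decidable_on decidable_on_eq
      computable_mult computable_code_weight recursive_test_bound computation_rules D) auto

end

section \<open>Correctness\<close>

lemma closed_window_condition: "closed {x. \<forall>i. G (window x i l)}"
proof -
  have "- {x. \<forall>i. G (window x i l)} = (\<Union>i. \<Union>a\<in>{a. \<not> G a}. {x. window x i l = a})"
    by auto
  then show ?thesis
    unfolding closed_def by (auto intro!: open_UN open_cylinder)
qed

lemma shift_of_finite_type_eq_windows:
  "shift_of_finite_type A = {x. \<forall>i. (\<lambda>a. a ! 0 < dim_row A \<and> A $$ (a ! 0, a ! 1) = 1) (window x i 2)}"
  unfolding shift_of_finite_type_def by auto

lemma shift_image_shift_of_finite_type: "shift ` shift_of_finite_type A = shift_of_finite_type A"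
proof
  show "shift ` shift_of_finite_type A \<subseteq> shift_of_finite_type A"
    by (auto simp: shift_of_finite_type_def shift_def)
  show "shift_of_finite_type A \<subseteq> shift ` shift_of_finite_type A"
  proof
    fix x assume x: "x \<in> shift_of_finite_type A"
    have "\<forall>i. A $$ (x i, x (i + 1)) = 1"
      using x by (simp add: shift_of_finite_type_def)
    then have "A $$ (x (i - 1), x (i - 1 + 1)) = 1" for i by blast
    then have "(\<lambda>i. x (i - 1)) \<in> shift_of_finite_type A"
      using x by (simp add: shift_of_finite_type_def)
    then have "shift (\<lambda>i. x (i - 1)) \<in> shift ` shift_of_finite_type A" by (rule imageI)
    then show "x \<in> shift ` shift_of_finite_type A" by (simp add: shift_def)
  qed
qed

lemma stationary_vector_sum:
  assumes P: "P \<in> carrier_mat n n" and p: "stationary_vector P p" and j: "j < n"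
  shows "(\<Sum>i<n. vec_index p i * P $$ (i, j)) = vec_index p j"
proof -
  have dims: "dim_row P = n" "dim_col P = n" "dim_vec p = n"
    using P p by (auto simp: stationary_vector_def)
  have "vec_index p j = vec_index (P\<^sup>T *\<^sub>v p) j" using p by (simp add: stationary_vector_def)
  also have "\<dots> = (\<Sum>i = 0..<n. P $$ (i, j) * vec_index p i)"
    using j dims by (simp add: scalar_prod_def)
  finally show ?thesis by (simp add: mult.commute atLeast0LessThan)
qed

lemma hidden_markov_chain_of_markov_measure:
  assumes A: "irreducible_matrix A" and \<mu>: "markov_measure A P \<mu>"
  shows "\<exists>p. hidden_markov_chain (dim_row A) (shift_of_finite_type A) \<mu> p (\<lambda>i j. P $$ (i, j)) \<and>
    (\<forall>i<dim_row A. 0 \<le> p i) \<and> (\<Sum>i<dim_row A. p i) = 1 \<and>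
    (\<forall>j<dim_row A. (\<Sum>i<dim_row A. p i * P $$ (i, j)) = p j)"
proof -
  let ?n = "dim_row A" and ?\<Omega> = "shift_of_finite_type A"
  from \<mu> obtain p where P: "stochastic_for A P" and inv: "invariant_prob ?\<Omega> \<mu>"
    and p: "stationary_vector P p"
    and cyl: "\<And>t a. length a = t + 1 \<Longrightarrow> set a \<subseteq> {..<?n} \<Longrightarrow>
      measure \<mu> {x \<in> space \<mu>. segment x 0 (int t) = a} = vec_index p (a ! 0) * (\<Prod>i<t. P $$ (a ! i, a ! (i + 1)))"
    unfolding markov_measure_def by blast
  have "dim_col A = ?n" using A by (simp add: irreducible_matrix_def square_mat.simps)
  then have P_carrier: "P \<in> carrier_mat ?n ?n" using P by (simp add: stochastic_for_def)
  have space: "space \<mu> = ?\<Omega>" using inv by (simp add: invariant_prob_def)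
  show ?thesis
  proof (intro exI [of _ "\<lambda>i. vec_index p i"] conjI allI impI)
    show "hidden_markov_chain ?n ?\<Omega> \<mu> (\<lambda>i. vec_index p i) (\<lambda>i j. P $$ (i, j))"
    proof (unfold_locales)
      show "closed ?\<Omega>"
        unfolding shift_of_finite_type_eq_windows by (rule closed_window_condition)
      show "shift ` ?\<Omega> = ?\<Omega>" by (rule shift_image_shift_of_finite_type)
      show "x i < ?n" if "x \<in> ?\<Omega>" for x i
        using that by (simp add: shift_of_finite_type_def)
      show "invariant_prob ?\<Omega> \<mu>" by (rule inv)
      show "measure \<mu> {x \<in> ?\<Omega>. segment x 0 (int k) = a} = path_weight (\<lambda>i. vec_index p i) (\<lambda>i j. P $$ (i, j)) a"
        if "length a = Suc k" "set a \<subseteq> {..<?n}" for a k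
        using cyl [of a k] that by (simp add: space path_weight_def)
    qed
    have "dim_row P = ?n" using P_carrier by simp
    then show "0 \<le> vec_index p i" if "i < ?n" for i
      using p that by (simp add: stationary_vector_def)
    show "(\<Sum>i<?n. vec_index p i) = 1"
      using p \<open>dim_row P = ?n\<close> by (simp add: stationary_vector_def)
    show "(\<Sum>i<?n. vec_index p i * P $$ (i, j)) = vec_index p j" if "j < ?n" for j
      by (rule stationary_vector_sum [OF P_carrier p that])
  qed
qed

lemma list_element_le_list_encode: "y \<in> set ys \<Longrightarrow> y \<le> list_encode ys"
proof (induction ys)
  case (Cons a ys)
  have "a \<le> prod_encode (a, list_encode ys)" "list_encode ys \<le> prod_encode (a, list_encode ys)"
    by (rule le_prod_encode_1, rule le_prod_encode_2)
  with Cons show ?case by fastforce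
qed simp

lemma entry_list_encode: "i < length ys \<Longrightarrow> entry (list_encode ys) i = ys ! i"
  by (simp add: entry_def)

lemma set_n_lists_upt: "set (List.n_lists l [0..<n]) = words n l"
  by (auto simp: set_n_lists words_def)

lemma word_length_list_encode [simp]: "word_length (list_encode ys) = length ys"
  by (simp add: word_length_def)

lemma mat_encode_entry:
  assumes "i < dim_row M" "j < dim_col M"
  shows "entry (entry (mat_encode M) i) j = M $$ (i, j)"
  using assms by (simp add: mat_encode_def mat_to_list_def entry_list_encode)

lemma word_length_mat_encode [simp]: "word_length (mat_encode M) = dim_row M"
  by (simp add: mat_encode_def mat_to_list_def)

text \<open>
  A valid input; its code is called \<open>x\<close>.
\<close>

locale decision_instance = real_codes K rep for K rep +
  fixes A :: "nat mat" and P :: "real mat" and C :: "nat mat" and s t :: nat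
    and \<Phi> :: "nat list \<Rightarrow> nat" and \<mu> :: "(int \<Rightarrow> nat) measure"
  assumes irreducible: "irreducible_matrix A" and markov: "markov_measure A P \<mu>"
    and codes: "represents_mat rep C P"
begin

abbreviation n :: nat where "n \<equiv> dim_row A"

definition x :: nat where "x = input_encode A C s t \<Phi>"

abbreviation P' :: "nat \<Rightarrow> nat \<Rightarrow> real" where "P' \<equiv> \<lambda>i j. P $$ (i, j)"

lemma P_carrier: "P \<in> carrier_mat n n"
  using irreducible markov
  by (simp add: irreducible_matrix_def square_mat.simps markov_measure_def stochastic_for_def)

lemma C_carrier: "C \<in> carrier_mat n n"
proof -
  have "map_mat rep C = map_mat Some P" using codes by (simp add: represents_mat_def)
  then have "dim_row C = dim_row P" "dim_col C = dim_col P"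
    by (metis index_map_mat(2), metis index_map_mat(3))
  then show ?thesis using P_carrier by auto
qed

lemma rep_C: "i < n \<Longrightarrow> j < n \<Longrightarrow> rep (C $$ (i, j)) = Some (P $$ (i, j))"
proof -
  assume ij: "i < n" "j < n"
  have "map_mat rep C $$ (i, j) = map_mat Some P $$ (i, j)"
    using codes by (simp add: represents_mat_def)
  then show ?thesis using ij C_carrier P_carrier by simp
qed

lemma input_entries:
  "entry x (Suc 0) = mat_encode C" "entry x 2 = s" "entry x 3 = t"
  "entry x 4 = block_map_encode n s t \<Phi>"
  by (simp_all add: x_def input_encode_def entry_def)

lemma state_count_x [simp]: "state_count x = n"
  using C_carrier by (simp add: state_count_def input_entries)

lemma memory_x [simp]: "memory x = s + t"
  by (simp add: memory_def input_entries)

lemma rep_entry_code: "i < n \<Longrightarrow> j < n \<Longrightarrow> rep (entry_code x i j) = Some (P' i j)"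
  using rep_C C_carrier by (simp add: entry_code_def input_entries mat_encode_entry)

lemma represented_x: "represented x"
  by (simp add: represented_def rep_entry_code)

lemma coefficient_x: "i < n \<Longrightarrow> j < n \<Longrightarrow> coefficient x i j = P' i j"
  by (simp add: coefficient_def rep_entry_code)

definition monomial_code :: "(nat \<times> nat) list \<Rightarrow> nat" where
  "monomial_code m = list_encode (map prod_encode m)"

definition polynomial_code :: "(nat \<times> (nat \<times> nat) list) list \<Rightarrow> nat" where
  "polynomial_code ms = list_encode (map (\<lambda>(\<sigma>, m). prod_encode (\<sigma>, monomial_code m)) ms)"

lemma prod_list_eq_prod_nth: "prod_list xs = (\<Prod>i<length xs. xs ! i)" for xs :: "real list"
  using prod.list_conv_set_nth [of xs] by (simp add: atLeast0LessThan)

lemma monomial_value_code: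
  assumes "set m \<subseteq> {..<n} \<times> {..<n}"
  shows "monomial_value x (monomial_code m) = prod_list (map (case_prod P') m)"
proof -
  have "monomial_value x (monomial_code m) =
      (\<Prod>k<length m. coefficient x (fst (m ! k)) (snd (m ! k)))"
    by (simp add: monomial_value_def monomial_code_def entry_list_encode fst_code_def snd_code_def)
  also have "\<dots> = (\<Prod>k<length m. map (case_prod P') m ! k)"
  proof (intro prod.cong refl)
    fix k assume "k \<in> {..<length m}"
    moreover from this assms have "m ! k \<in> {..<n} \<times> {..<n}" using nth_mem by blast
    ultimately show "coefficient x (fst (m ! k)) (snd (m ! k)) = map (case_prod P') m ! k"
      by (auto simp: coefficient_x case_prod_beta)
  qed
  finally show ?thesis by (simp add: prod_list_eq_prod_nth)
qed

lemma polynomial_value_code: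
  assumes "\<forall>y\<in>set ms. set (snd y) \<subseteq> {..<n} \<times> {..<n}"
  shows "polynomial_value x (polynomial_code ms) = signed_sum (case_prod P') ms"
proof -
  have "polynomial_value x (polynomial_code ms) =
      (\<Sum>k<length ms. (- 1) ^ fst (ms ! k) * monomial_value x (monomial_code (snd (ms ! k))))"
    by (simp add: polynomial_value_def polynomial_code_def entry_list_encode case_prod_beta)
  also have "\<dots> = (\<Sum>k<length ms. (- 1) ^ fst (ms ! k) * prod_list (map (case_prod P') (snd (ms ! k))))"
    using assms by (intro sum.cong) (simp_all add: monomial_value_code)
  also have "\<dots> = signed_sum (case_prod P') ms"
    by (simp add: signed_sum_def sum_list_sum_nth atLeast0LessThan case_prod_beta)
  finally show ?thesis .
qed

lemma codes_fixed_vector_x: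
  "codes_fixed_vector x m \<longleftrightarrow>
    (\<forall>j<n. (\<Sum>i<n. polynomial_value x (entry m i) * P' i j) = polynomial_value x (entry m j)) \<and>
    (\<exists>i<n. polynomial_value x (entry m i) \<noteq> 0)"
  unfolding codes_fixed_vector_def by (simp add: coefficient_x)

text \<open>
  The search for a stationary vector succeeds.
\<close>

lemma ex_codes_fixed_vector: "\<exists>m. codes_fixed_vector x m"
proof -
  obtain p where p: "(\<Sum>i<n. p i) = 1" "\<forall>j<n. (\<Sum>i<n. p i * P' i j) = p j"
    using hidden_markov_chain_of_markov_measure [OF irreducible markov] by auto
  obtain ms where ms: "\<And>i. \<forall>y\<in>set (ms i). set (snd y) \<subseteq> {..<n} \<times> {..<n}"
    "\<exists>i<n. signed_sum (case_prod P') (ms i) \<noteq> 0"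
    "\<And>j. j < n \<Longrightarrow> (\<Sum>i<n. signed_sum (case_prod P') (ms i) * P' i j) = signed_sum (case_prod P') (ms j)"
    using fixed_vector_signed_sum [of p n P', OF p(1) p(2) [rule_format]] by blast
  define m where "m = list_encode (map (\<lambda>i. polynomial_code (ms i)) [0..<n])"
  have "polynomial_value x (entry m i) = signed_sum (case_prod P') (ms i)" if "i < n" for i
    using that ms(1) by (simp add: m_def entry_list_encode polynomial_value_code)
  then have "codes_fixed_vector x m"
    unfolding codes_fixed_vector_x using ms(2,3) by auto
  then show ?thesis ..
qed

text \<open>
  Every window occurs exactly once as a key of the table, so the matching line is the one of the
  window that is being read.
\<close>

lemma table_lookup:
  assumes a: "a \<in> words n (l + Suc (s + t))" and k: "k < l"
  shows "(\<exists>j<word_length (entry x 4).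
        (\<forall>r<Suc (s + t). entry (fst_code (entry (entry x 4) j)) r = entry (list_encode a) (k + r)) \<and>
        snd_code (entry (entry x 4) j) = b) \<longleftrightarrow> \<Phi> (take (Suc (s + t)) (drop k a)) = b"
proof -
  let ?ws = "List.n_lists (s + t + 1) [0..<n]"
  let ?w = "take (Suc (s + t)) (drop k a)"
  have ws: "set ?ws = words n (Suc (s + t))"
    unfolding set_n_lists_upt by simp
  have len: "length a = l + Suc (s + t)" using a by (simp add: words_def)
  have w_mem: "?w \<in> words n (Suc (s + t))"
    using a k by (auto simp: words_def dest!: in_set_takeD in_set_dropD)
  have key: "(\<forall>r<Suc (s + t). entry (list_encode w) r = entry (list_encode a) (k + r)) \<longleftrightarrow> w = ?w"
    if "w \<in> words n (Suc (s + t))" for w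
    using that len k by (auto simp: words_def entry_list_encode list_eq_iff_nth_eq)
  have table: "entry (entry x 4) j = prod_encode (list_encode (?ws ! j), \<Phi> (?ws ! j))"
    if "j < length ?ws" for j
    using that by (simp add: input_entries block_map_encode_def entry_list_encode)
  have "(\<exists>j<word_length (entry x 4).
        (\<forall>r<Suc (s + t). entry (fst_code (entry (entry x 4) j)) r = entry (list_encode a) (k + r)) \<and>
        snd_code (entry (entry x 4) j) = b) \<longleftrightarrow>
      (\<exists>j<length ?ws. (\<forall>r<Suc (s + t). entry (list_encode (?ws ! j)) r = entry (list_encode a) (k + r)) \<and>
        \<Phi> (?ws ! j) = b)"
  proof -
    have "word_length (entry x 4) = length ?ws"
      by (simp add: input_entries block_map_encode_def)
    then show ?thesis using table by auto
  qed
  also have "\<dots> \<longleftrightarrow> (\<exists>w\<in>set ?ws. (\<forall>r<Suc (s + t). entry (list_encode w) r = entry (list_encode a) (k + r)) \<and> \<Phi> w = b)"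
    by (metis in_set_conv_nth)
  also have "\<dots> \<longleftrightarrow> \<Phi> ?w = b"
    unfolding ws using key w_mem by blast
  finally show ?thesis .
qed

definition subword :: "nat \<Rightarrow> nat \<Rightarrow> nat \<Rightarrow> nat list" where
  "subword b i l = map (\<lambda>k. entry b (i + k)) [0..<l]"

lemma codes_preimage_x:
  "codes_preimage x (list_encode a) b i l \<longleftrightarrow> a \<in> preimage_words n \<Phi> (s + t) (subword b i l)"
proof -
  have letters: "(\<forall>k<length a. entry (list_encode a) k < n) \<longleftrightarrow> set a \<subseteq> {..<n}"
    unfolding subset_eq all_set_conv_all_nth by (simp add: entry_list_encode)
  show ?thesis
  proof (cases "a \<in> words n (l + Suc (s + t))")
    case True
    then show ?thesis
      using letters
      by (auto simp: codes_preimage_def table_lookup [OF True] preimage_words_def reads_def subword_def words_def)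
  next
    case False
    then show ?thesis
      using letters by (auto simp: codes_preimage_def preimage_words_def subword_def words_def)
  qed
qed

text \<open>
  Only words over \<open>{..<n}\<close> count, so the bound on the codes loses no preimage.  The factor \<open>c\<close> is the
  one by which the vector found by the search differs from the stationary vector.
\<close>

lemma code_weight_x:
  assumes q: "\<And>i. i < n \<Longrightarrow> polynomial_value x (entry m i) = c * p i"
  shows "code_weight x m b i l = c * word_weight n p P' \<Phi> (s + t) (subword b i l)"
proof -
  let ?S = "preimage_words n \<Phi> (s + t) (subword b i l)"
  let ?f = "\<lambda>c. polynomial_value x (entry m (entry c 0)) *
       (\<Prod>k<word_length c - 1. coefficient x (entry c k) (entry c (Suc k)))"
  let ?B = "word_bound n (l + Suc (s + t))"
  have mem: "length a = l + Suc (s + t)" "set a \<subseteq> {..<n}" if "a \<in> ?S" for a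
    using that by (auto simp: preimage_words_def words_def subword_def)
  have less: "list_encode a < ?B" if "a \<in> ?S" for a
    using mem [OF that] by (intro list_encode_less_word_bound) auto
  have "code_weight x m b i l = (\<Sum>c<?B. if codes_preimage x c b i l then ?f c else 0)"
    by (simp add: code_weight_def)
  also have "\<dots> = (\<Sum>c\<in>{c \<in> {..<?B}. codes_preimage x c b i l}. ?f c)"
    by (rule sum.inter_filter [symmetric]) simp
  also have "{c \<in> {..<?B}. codes_preimage x c b i l} = list_encode ` ?S"
  proof (intro subset_antisym subsetI)
    fix c assume "c \<in> {c \<in> {..<?B}. codes_preimage x c b i l}"
    then have "list_decode c \<in> ?S" using codes_preimage_x [of "list_decode c"] by simp
    then show "c \<in> list_encode ` ?S" by (metis image_eqI list_decode_inverse)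
  next
    fix c assume "c \<in> list_encode ` ?S"
    then show "c \<in> {c \<in> {..<?B}. codes_preimage x c b i l}" using less codes_preimage_x by auto
  qed
  also have "(\<Sum>c\<in>list_encode ` ?S. ?f c) = (\<Sum>a\<in>?S. ?f (list_encode a))"
    using inj_list_encode by (simp add: sum.reindex)
  also have "\<dots> = (\<Sum>a\<in>?S. c * path_weight p P' a)"
  proof (intro sum.cong refl)
    fix a assume "a \<in> ?S"
    note a = mem [OF this]
    have nth: "a ! k < n" if "k < length a" for k
      using a that nth_mem by blast
    have "(\<Prod>k<length a - 1. coefficient x (entry (list_encode a) k) (entry (list_encode a) (Suc k))) =
        (\<Prod>k<length a - 1. P' (a ! k) (a ! Suc k))"
      using nth by (intro prod.cong) (auto simp: entry_list_encode coefficient_x)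
    moreover have "polynomial_value x (entry m (entry (list_encode a) 0)) = c * p (a ! 0)"
      using nth [of 0] a q by (simp add: entry_list_encode)
    ultimately show "?f (list_encode a) = c * path_weight p P' a"
      by (simp add: path_weight_def)
  qed
  finally show ?thesis by (simp add: word_weight_def sum_distrib_left)
qed

lemma subword_append: "subword b i (k + l) = subword b i k @ subword b (i + k) l"
  by (rule nth_equalityI) (auto simp: subword_def nth_append)

text \<open>
  The factor \<open>c\<close> enters both sides of each equation as \<open>c\<^sup>2\<close>, and it is not zero; so the result of the
  test is the same for all vectors that the search may find.  The code \<open>x\<close> itself bounds the letters
  of the image, all of which occur in the table.
\<close>

theorem markov_test_x:
  assumes m: "codes_fixed_vector x m"
  shows "markov_test x m \<longleftrightarrow>
    is_markov (block_code s t \<Phi> ` shift_of_finite_type A) (image_measure (block_code s t \<Phi>) \<mu>)"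
proof -
  obtain p where chain: "hidden_markov_chain n (shift_of_finite_type A) \<mu> p P'"
    and p: "\<forall>i<n. 0 \<le> p i" "(\<Sum>i<n. p i) = 1" "\<forall>j<n. (\<Sum>i<n. p i * P' i j) = p j"
    using hidden_markov_chain_of_markov_measure [OF irreducible markov] by auto
  interpret hidden_markov_chain n "shift_of_finite_type A" \<mu> p P' s t \<Phi> by (rule chain)
  have "connected_weights n P'"
    using irreducible_connected_weights [OF irreducible] markov by (simp add: markov_measure_def)
  from fixed_vector_unique [OF this p(1) [rule_format] p(2) p(3) [rule_format], of "\<lambda>i. polynomial_value x (entry m i)"] m
  obtain c where c: "\<And>i. i < n \<Longrightarrow> polynomial_value x (entry m i) = c * p i"
    unfolding codes_fixed_vector_x by blast
  have "c \<noteq> 0" using m c unfolding codes_fixed_vector_x by auto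
  define B where "B = test_bound x"
  have B: "1 \<le> B" "card (words n (Suc (s + t))) * card (words n (Suc (s + t))) \<le> B"
    using card_lists_length_eq [of "{..<n}" "Suc (s + t)"]
    by (simp_all add: B_def test_bound_def words_def conj_commute)
  have "alphabet \<subseteq> {..x}"
  proof
    fix b assume "b \<in> alphabet"
    then obtain w where w: "w \<in> words n (Suc (s + t))" "b = \<Phi> w" by (auto simp: alphabet_def)
    have "b \<le> prod_encode (list_encode w, \<Phi> w)" unfolding w(2) by (rule le_prod_encode_2)
    also have "\<dots> \<le> block_map_encode n s t \<Phi>"
      unfolding block_map_encode_def
      unfolding Suc_eq_plus1 [symmetric]
      using w(1) by (intro list_element_le_list_encode) (simp add: set_n_lists_upt del: List.n_lists.simps)
    also have "\<dots> \<le> x"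
      unfolding x_def input_encode_def by (rule list_element_le_list_encode) simp
    finally show "b \<in> {..x}" by simp
  qed
  note finite_test = is_markov_iff_finite_test [OF B this]
  let ?eq = "\<lambda>w u v. weight (w @ u @ v) * weight u = weight (w @ u) * weight (u @ v)"
  have eq: "code_weight x m b 0 l * code_weight x m b i (j - i) =
        code_weight x m b 0 j * code_weight x m b i (l - i) \<longleftrightarrow>
      ?eq (subword b 0 i) (subword b i (j - i)) (subword b j (l - j))" if ij: "i \<le> j" "j \<le> l" for b i j l
  proof -
    have "subword b 0 j = subword b 0 i @ subword b i (j - i)"
      using subword_append [of b 0 i "j - i"] ij by simp
    moreover have "subword b 0 l = subword b 0 j @ subword b j (l - j)"
      using subword_append [of b 0 j "l - j"] ij by simp
    moreover have "subword b i (l - i) = subword b i (j - i) @ subword b j (l - j)"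
      using subword_append [of b i "j - i" "l - j"] ij by simp
    ultimately show ?thesis
      using \<open>c \<noteq> 0\<close> by (simp add: code_weight_x [OF c])
  qed
  show ?thesis
    unfolding finite_test
  proof
    assume "markov_test x m"
    then have test': "code_weight x m b 0 l * code_weight x m b i (j - i) =
        code_weight x m b 0 j * code_weight x m b i (l - i)"
      if "b < word_bound x (3 * B)" "l < Suc (3 * B)" "j < Suc l" "i < Suc j" "i + B \<le> j" for b l j i
      using that unfolding markov_test_def B_def by blast
    show "\<forall>w u v. B \<le> length u \<and> length (w @ u @ v) \<le> 3 * B \<and> set (w @ u @ v) \<subseteq> {..x} \<longrightarrow> ?eq w u v"
    proof (intro allI impI)
      fix w u v :: "nat list"
      assume wuv: "B \<le> length u \<and> length (w @ u @ v) \<le> 3 * B \<and> set (w @ u @ v) \<subseteq> {..x}"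
      define b where "b = list_encode (w @ u @ v)"
      let ?l = "length (w @ u @ v)" and ?j = "length (w @ u)" and ?i = "length w"
      have "b < word_bound x (3 * B)"
        unfolding b_def using wuv by (intro list_encode_less_word_bound) auto
      then have "code_weight x m b 0 ?l * code_weight x m b ?i (?j - ?i) =
          code_weight x m b 0 ?j * code_weight x m b ?i (?l - ?i)"
        using wuv by (intro test') auto
      moreover have "subword b 0 ?i = w" "subword b ?i (?j - ?i) = u" "subword b ?j (?l - ?j) = v"
        by (auto simp: subword_def b_def entry_list_encode nth_append intro!: nth_equalityI)
      ultimately show "?eq w u v" using eq [of ?i ?j ?l b] by simp
    qed
  next
    assume test: "\<forall>w u v. B \<le> length u \<and> length (w @ u @ v) \<le> 3 * B \<and> set (w @ u @ v) \<subseteq> {..x} \<longrightarrow> ?eq w u v"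
    have long: "?eq w u v" if "B \<le> length u" for w u v
    proof -
      have "is_markov Y \<nu>" using test finite_test by blast
      then have "splits_at weight u" using is_markov_iff_splits_bounded [OF B] that by blast
      then show ?thesis by (simp add: splits_at_def)
    qed
    show "markov_test x m"
      unfolding markov_test_def B_def [symmetric]
    proof (intro allI impI)
      fix b l j i assume "j < Suc l" "i < Suc j" "i + B \<le> j"
      then have ij: "i \<le> j" "j \<le> l" and "B \<le> length (subword b i (j - i))"
        by (auto simp: subword_def)
      then show "code_weight x m b 0 l * code_weight x m b i (j - i) =
          code_weight x m b 0 j * code_weight x m b i (l - i)"
        unfolding eq [OF ij] using long by blast
    qed
  qed
qed

end

theorem corollary5p7:
  fixes K :: "real set" and rep :: "nat \<rightharpoonup> real"
  assumes "computable_field K rep"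
  shows "\<exists>D. partial_recursive D \<and>
    (\<forall>(A :: nat mat) (P :: real mat) (C :: nat mat) (s :: nat) (t :: nat)
       (\<Phi> :: nat list \<Rightarrow> nat) (\<mu> :: (int \<Rightarrow> nat) measure).
       zero_one_matrix A \<and> irreducible_matrix A \<and> markov_measure A P \<mu> \<and>
       field_generated_by (elements_mat P) \<subseteq> K \<and> represents_mat rep C P \<longrightarrow>
       D (input_encode A C s t \<Phi>) =
         Some (of_bool (is_markov (block_code s t \<Phi> ` shift_of_finite_type A)
                                  (image_measure (block_code s t \<Phi>) \<mu>))))"
proof -
  interpret real_codes K rep by unfold_locales (rule assms)
  define D where "D x \<longleftrightarrow> (\<exists>A P C s t \<Phi> \<mu>. decision_instance K rep A P C \<mu> \<and>
    x = input_encode A C s t \<Phi>)" for x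
  define Q where "Q x \<longleftrightarrow> (\<exists>m. codes_fixed_vector x m \<and> markov_test x m)" for x
  have represented: "represented x" and witness: "\<exists>m. codes_fixed_vector x m"
    and independent: "codes_fixed_vector x m \<Longrightarrow> markov_test x m \<longleftrightarrow> Q x" if "D x" for x m
  proof -
    from \<open>D x\<close> obtain A P C s t \<Phi> \<mu> where inst: "decision_instance K rep A P C \<mu>"
      and x: "x = input_encode A C s t \<Phi>" unfolding D_def by blast
    interpret I: decision_instance K rep A P C s t \<Phi> \<mu> by (rule inst)
    have x': "x = I.x" using x by (simp add: I.x_def)
    show "represented x" unfolding x' by (rule I.represented_x)
    show "\<exists>m. codes_fixed_vector x m" unfolding x' by (rule I.ex_codes_fixed_vector)
    show "markov_test x m \<longleftrightarrow> Q x" if "codes_fixed_vector x m"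
      using that I.markov_test_x unfolding x' Q_def by blast
  qed
  have "decidable_on D Q"
    by (rule decidable_on_witness [OF decidable_codes_fixed_vector witness decidable_markov_test independent])
      (auto intro: represented)
  then obtain F where F: "partial_recursive F" "\<And>x. D x \<Longrightarrow> F x = Some (of_bool (Q x))"
    unfolding decidable_on_def by blast
  show ?thesis
  proof (intro exI [of _ F] conjI allI impI F(1))
    fix A :: "nat mat" and P :: "real mat" and C :: "nat mat" and s t :: nat
      and \<Phi> :: "nat list \<Rightarrow> nat" and \<mu> :: "(int \<Rightarrow> nat) measure"
    assume "zero_one_matrix A \<and> irreducible_matrix A \<and> markov_measure A P \<mu> \<and>
       field_generated_by (elements_mat P) \<subseteq> K \<and> represents_mat rep C P"
    then have inst: "decision_instance K rep A P C \<mu>"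
      by unfold_locales auto
    interpret I: decision_instance K rep A P C s t \<Phi> \<mu> by (rule inst)
    have "D I.x" unfolding D_def I.x_def using inst by blast
    moreover obtain m where "codes_fixed_vector I.x m" using I.ex_codes_fixed_vector ..
    ultimately show "F (input_encode A C s t \<Phi>) =
        Some (of_bool (is_markov (block_code s t \<Phi> ` shift_of_finite_type A)
                                 (image_measure (block_code s t \<Phi>) \<mu>)))"
      using F(2) [of I.x] independent I.markov_test_x by (simp add: I.x_def)
  qed
qed

end
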